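(* Let $A,B\subset\mathbb{R}^m$ be closed sets in the smooth transverse setting (see context), and let $x^*\in A\cap B$ be the transversal intersection point. Then there exist $c_1,c_2>0$, $\delta_0>0$, and a neighborhood $U$ of $x^*$ such that for all $x_0\in U$ and $\delta\in(0,\delta_0]$, $$T^*_\delta(x_0)\le c_1+c_2\log\frac1\delta .$$ Moreover, for the discrete RRR iteration $x_{k+1}=x_k+\varepsilon v(x_k)$ started at $x_0$, $$t^*_\delta(\varepsilon;x_0)=T^*_\delta(x_0)+O(\varepsilon),\qquad \varepsilon\downarrow0,$$ where the $O(\varepsilon)$ term is uniform for $x_0$ in compact subsets of $U$.
   Context: For closed sets $A,B\subset\mathbb{R}^m$ let $P_A,P_B$ be the metric (nearest-point) projections, $R_A:=2P_A-\mathrm{Id}$, and $v(x):=P_B(R_Ax)-P_Ax$ (the RRR flow field). Smooth transverse setting: $A$ and $B$ are $C^2$ embedded submanifolds of $\mathbb{R}^m$ that intersect transversally at $x^*\in A\cap B$. In a sufficiently small neighborhood of $x^*$ the projections $P_A$ and $P_B$ are single-valued and $C^1$, and their derivatives at $x^*$ are the orthogonal projectors onto $T_{x^*}A$, $T_{x^*}B$. The intersection $M:=A\cap B$ is then a $C^2$ submanifold, and $P_A,P_B$ restrict to the identity on $M$ near $x^*$. Hitting times: for $\delta>0$, $T^*_\delta(x_0):=\inf\{t\ge0:\|v(x(t))\|\le\delta\}$, where $x(\cdot)$ solves $\dot x=v(x)$, $x(0)=x_0$; and $t^*_\delta(\varepsilon;x_0):=k\varepsilon$, where $k$ is the smallest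 index with $\|v(x_k)\|\le\delta$. Both are $+\infty$ if no such time or index exists. *)

theory Defs
  imports "HOL-Analysis.Analysis"
begin

definition C2_on :: "('a::real_normed_vector \<Rightarrow> 'b::real_normed_vector) \<Rightarrow> 'a set \<Rightarrow> bool"
  where "C2_on f W \<longleftrightarrow>
    (\<exists>(f' :: 'a \<Rightarrow> 'a \<Rightarrow>\<^sub>L 'b) (f'' :: 'a \<Rightarrow> 'a \<Rightarrow>\<^sub>L ('a \<Rightarrow>\<^sub>L 'b)).
       (\<forall>x\<in>W. (f has_derivative blinfun_apply (f' x)) (at x)) \<and>
       (\<forall>x\<in>W. (f' has_derivative blinfun_apply (f'' x)) (at x)) \<and>
       continuous_on W f'')"

definition C2_diffeomorphism ::
    "'a::real_normed_vector set \<Rightarrow> 'a set \<Rightarrow> ('a \<Rightarrow> 'a) \<Rightarrow> ('a \<Rightarrow> 'a) \<Rightarrow> bool"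
  where "C2_diffeomorphism W W' \<phi> \<psi> \<longleftrightarrow>
    open W \<and> open W' \<and> homeomorphism W W' \<phi> \<psi> \<and> C2_on \<phi> W \<and> C2_on \<psi> W'"

text \<open>Embedded submanifolds are described by slice charts: near each of its points the set is
  mapped onto an open piece of a linear subspace of fixed dimension by a \<open>C\<^sup>2\<close> diffeomorphism
  of the ambient space.\<close>

definition C2_submanifold :: "'a::euclidean_space set \<Rightarrow> bool"
  where "C2_submanifold S \<longleftrightarrow>
    (\<exists>d. \<forall>p\<in>S. \<exists>W W' \<phi> \<psi> V.
       p \<in> W \<and> C2_diffeomorphism W W' \<phi> \<psi> \<and>
       subspace V \<and> dim V = d \<and> \<phi> ` (S \<inter> W) = V \<inter> W')"

definition tangent_space :: "'a::euclidean_space set \<Rightarrow> 'a \<Rightarrow> 'a set"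
  where "tangent_space S p =
    {u. \<exists>\<gamma> e. e > 0 \<and> \<gamma> C1_differentiable_on {-e<..<e} \<and> \<gamma> ` {-e<..<e} \<subseteq> S \<and>
          \<gamma> 0 = p \<and> (\<gamma> has_vector_derivative u) (at (0::real))}"

definition transversal_at :: "'a::euclidean_space set \<Rightarrow> 'a set \<Rightarrow> 'a \<Rightarrow> bool"
  where "transversal_at A B p \<longleftrightarrow>
    p \<in> A \<inter> B \<and> {u + w | u w. u \<in> tangent_space A p \<and> w \<in> tangent_space B p} = UNIV"

text \<open>The metric projection is \<^const>\<open>closest_point\<close>. Where the nearest point is not unique,
  it denotes an arbitrary but fixed choice among the nearest points.\<close>

definition reflection :: "'a::euclidean_space set \<Rightarrow> 'a \<Rightarrow> 'a"
  where "reflection A x = 2 *\<^sub>R closest_point A x - x"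

definition rrr_field :: "'a::euclidean_space set \<Rightarrow> 'a set \<Rightarrow> 'a \<Rightarrow> 'a"
  where "rrr_field A B x = closest_point B (reflection A x) - closest_point A x"

text \<open>Only the values of a trajectory at nonnegative times are constrained.\<close>

definition rrr_solution :: "'a::euclidean_space set \<Rightarrow> 'a set \<Rightarrow> 'a \<Rightarrow> (real \<Rightarrow> 'a) \<Rightarrow> bool"
  where "rrr_solution A B x0 x \<longleftrightarrow>
    x 0 = x0 \<and>
    (\<forall>t\<ge>0. (x has_vector_derivative rrr_field A B (x t)) (at t within {0..}))"

text \<open>If the initial value problem has exactly one solution on \<open>[0, \<infinity>)\<close>, the following is the
  hitting time of that solution. The infimum of the empty set is \<open>\<infinity>\<close>.\<close>

definition flow_hitting_time :: "'a::euclidean_space set \<Rightarrow> 'a set \<Rightarrow> real \<Rightarrow> 'a \<Rightarrow> ereal"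
  where "flow_hitting_time A B \<delta> x0 =
    Inf {ereal t | t x. rrr_solution A B x0 x \<and> 0 \<le> t \<and> norm (rrr_field A B (x t)) \<le> \<delta>}"

definition rrr_iterate :: "'a::euclidean_space set \<Rightarrow> 'a set \<Rightarrow> real \<Rightarrow> 'a \<Rightarrow> nat \<Rightarrow> 'a"
  where "rrr_iterate A B \<epsilon> x0 k = ((\<lambda>x. x + \<epsilon> *\<^sub>R rrr_field A B x) ^^ k) x0"

definition discrete_hitting_time ::
    "'a::euclidean_space set \<Rightarrow> 'a set \<Rightarrow> real \<Rightarrow> real \<Rightarrow> 'a \<Rightarrow> ereal"
  where "discrete_hitting_time A B \<delta> \<epsilon> x0 =
    (if \<exists>k. norm (rrr_field A B (rrr_iterate A B \<epsilon> x0 k)) \<le> \<delta>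
     then ereal (real (LEAST k. norm (rrr_field A B (rrr_iterate A B \<epsilon> x0 k)) \<le> \<delta>) * \<epsilon>)
     else \<infinity>)"

end

theory Submission
  imports Defs
begin

text \<open>Only first-order information at \<open>x\<^sup>*\<close> is needed, in the strict form
  \<open>\<parallel>f x - f y - L (x - y)\<parallel> \<le> e * \<parallel>x - y\<parallel>\<close> for all \<open>x\<close>, \<open>y\<close> near \<open>x\<^sup>*\<close>. For \<open>f = P\<^sub>A\<close>, \<open>L\<close> the projector onto the
  tangent space, it follows from the first-order optimality condition, since the tangent spaces of \<open>A\<close>
  vary Lipschitz continuously. So \<open>v\<close> is strictly differentiable with derivative \<open>L = Q (2 P - 1) - P\<close>,
  and \<open>\<langle>L x, x\<rangle> = - \<parallel>L x\<parallel>\<^sup>2\<close> because \<open>1 + 2 L\<close> is a product of two reflections.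

  With \<open>a = P\<^sub>A x\<close>, \<open>y = 2 a - x\<close>, \<open>b = P\<^sub>B y\<close> one has \<open>- v x = (x - a) + (y - b)\<close>, a sum of an almost normal vector
  to \<open>A\<close> and one to \<open>B\<close>. By transversality \<open>L\<close> is bounded below on such sums, hence a step
  \<open>x + h * v x\<close> with \<open>h \<le> 1\<close> contracts the norm of \<open>v\<close> by the factor \<open>1 - \<kappa> h\<close>. The quantity \<open>\<parallel>x - x\<^sup>*\<parallel> + \<parallel>v x\<parallel> / \<kappa>\<close> then
  decreases along Euler orbits, and its sublevel set is an invariant neighbourhood. Decay and
  invariance pass to the flow by convergence of the Euler scheme, whose \<open>O(\<epsilon>)\<close> error,
  combined with the exponential decay through the level \<open>\<delta>\<close>, bounds the hitting time difference.\<close>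

section \<open>Orthogonal projectors and the linearised field\<close>

text \<open>For a subspace \<open>T\<close> these conditions determine \<open>P\<close>: two
  candidates differ at each point by an element of \<open>T\<close> that is orthogonal to
  \<open>T\<close>.\<close>

definition orthogonal_projector :: "'a::euclidean_space set \<Rightarrow> ('a \<Rightarrow> 'a) \<Rightarrow> bool"
  where "orthogonal_projector T P \<longleftrightarrow>
    linear P \<and> (\<forall>x. P x \<in> T) \<and> (\<forall>x. \<forall>t\<in>T. (x - P x) \<bullet> t = 0)"

text \<open>Fourier sum over an orthonormal basis of \<open>T\<close>; orthogonality of the residual
  is checked on basis vectors and extended to the span.\<close>

lemma orthogonal_projector_exists:
  fixes T :: "'a::euclidean_space set"
  assumes "subspace T"
  obtains P where "orthogonal_projector T P"
proof -
  obtain B where B: "B \<subseteq> T" "pairwise orthogonal B" "\<And>x. x \<in> B \<Longrightarrow> norm x = 1"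
      "independent B" "span B = T"
    using orthonormal_basis_subspace[OF assms] by metis
  have fin: "finite B"
    using B(4) by (rule independent_imp_finite)
  define P where "P x = (\<Sum>b\<in>B. (x \<bullet> b) *\<^sub>R b)" for x
  have "linear P"
    unfolding P_def
    by (rule linearI)
      (simp_all add: inner_add_left scaleR_add_left sum.distrib scaleR_right.sum)
  moreover have "P x \<in> T" for x
    unfolding P_def using B(1) assms by (intro subspace_sum subspace_scale) auto
  moreover have "(x - P x) \<bullet> t = 0" if "t \<in> T" for x t
  proof -
    have basis: "(x - P x) \<bullet> c = 0" if c: "c \<in> B" for c
    proof -
      have "P x \<bullet> c = (\<Sum>b\<in>B. if b = c then x \<bullet> c else 0)"
        unfolding P_def inner_sum_left
      proof (rule sum.cong[OF refl])
        fix b assume b: "b \<in> B"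
        show "(x \<bullet> b) *\<^sub>R b \<bullet> c = (if b = c then x \<bullet> c else 0)"
        proof (cases "b = c")
          case True
          with B(3)[OF c] show ?thesis by (simp add: dot_square_norm)
        next
          case False
          with B(2) b c have "b \<bullet> c = 0" by (auto simp: pairwise_def orthogonal_def)
          with False show ?thesis by simp
        qed
      qed
      also have "\<dots> = x \<bullet> c" using fin c by simp
      finally show ?thesis by (simp add: inner_diff_left)
    qed
    have "t \<in> span B" using that B(5) by simp
    then show ?thesis
      by (induction rule: span_induct_alt) (simp_all add: inner_add_right basis)
  qed
  ultimately show ?thesis
    using that unfolding orthogonal_projector_def by blast
qed

context
  fixes T :: "'a::euclidean_space set" and P
  assumes P: "orthogonal_projector T P"
begin

lemma orthogonal_projector_linear: "linear P"
  and orthogonal_projector_mem: "P x \<in> T"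
  and orthogonal_projector_orthogonal: "t \<in> T \<Longrightarrow> (x - P x) \<bullet> t = 0"
  using P unfolding orthogonal_projector_def by auto

lemma orthogonal_projector_inner: "t \<in> T \<Longrightarrow> P x \<bullet> t = x \<bullet> t"
  using orthogonal_projector_orthogonal[of t x] by (simp add: inner_diff_left)

lemma orthogonal_projector_zeroD: "P x = 0 \<Longrightarrow> t \<in> T \<Longrightarrow> x \<bullet> t = 0"
  using orthogonal_projector_inner[of t x] by simp

lemma orthogonal_projector_norm_sq: "(norm (P x))\<^sup>2 = x \<bullet> P x"
  using orthogonal_projector_inner[OF orthogonal_projector_mem, of x x]
  by (simp add: dot_square_norm)

lemma orthogonal_projector_norm_le: "norm (P x) \<le> norm x"
proof (cases "P x = 0")
  case False
  have "norm (P x) * norm (P x) \<le> norm x * norm (P x)"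
    using orthogonal_projector_norm_sq norm_cauchy_schwarz[of x "P x"]
    by (simp add: power2_eq_square)
  with False show ?thesis by simp
qed simp

lemma orthogonal_projector_closest:
  assumes "subspace T" "t \<in> T"
  shows "norm (x - P x) \<le> norm (x - t)"
proof -
  have "P x - t \<in> T"
    using assms orthogonal_projector_mem by (simp add: subspace_diff)
  then have "orthogonal (x - P x) (P x - t)"
    using orthogonal_projector_orthogonal by (simp add: orthogonal_def)
  then have "(norm (x - t))\<^sup>2 = (norm (x - P x))\<^sup>2 + (norm (P x - t))\<^sup>2"
    using norm_add_Pythagorean[of "x - P x" "P x - t"] by simp
  then have "(norm (x - P x))\<^sup>2 \<le> (norm (x - t))\<^sup>2" by simp
  then show ?thesis by (rule power2_le_imp_le) simp
qed

lemma orthogonal_projector_idem: "subspace T \<Longrightarrow> P (P x) = P x"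
  using orthogonal_projector_closest[of "P x" "P x"] orthogonal_projector_mem by simp

end

section \<open>The linearised RRR field\<close>

definition linear_rrr :: "('a \<Rightarrow> 'a) \<Rightarrow> ('a \<Rightarrow> 'a) \<Rightarrow> 'a::real_vector \<Rightarrow> 'a"
  where "linear_rrr P Q x = Q (2 *\<^sub>R P x - x) - P x"

lemma linear_linear_rrr:
  assumes "linear P" "linear Q"
  shows "linear (linear_rrr P Q)"
proof -
  have "linear (\<lambda>x. Q (2 *\<^sub>R P x - x) - P x)"
    using assms by (intro linear_compose_sub linear_compose_scale_right linear_ident
        linear_compose[OF _ assms(2), unfolded o_def])
  then show ?thesis unfolding linear_rrr_def[abs_def] .
qed

text \<open>With \<open>L = linear_rrr P Q\<close>, the vector \<open>x + 2 L x\<close> arises from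
  \<open>x\<close> by the reflections \<open>2 P - 1\<close> and \<open>2 Q - 1\<close>, so it has
  the norm of \<open>x\<close>, and expanding this equality gives the identity. The computation uses
  \<open>P x \<bullet> P x = x \<bullet> P x\<close> and the same for \<open>Q\<close> at the
  reflected point.\<close>

lemma linear_rrr_inner:
  assumes P: "orthogonal_projector S P" and Q: "orthogonal_projector T Q"
  shows "linear_rrr P Q x \<bullet> x = - (norm (linear_rrr P Q x))\<^sup>2"
proof -
  define y where "y = 2 *\<^sub>R P x - x"
  have 1: "P x \<bullet> P x = x \<bullet> P x"
    using orthogonal_projector_norm_sq[OF P] by (simp add: dot_square_norm)
  have 2: "Q y \<bullet> Q y = y \<bullet> Q y"
    using orthogonal_projector_norm_sq[OF Q] by (simp add: dot_square_norm)
  have "(Q y - P x) \<bullet> x + (Q y - P x) \<bullet> (Q y - P x) = 0"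
    using 2 unfolding y_def
    by (simp add: inner_diff_left inner_diff_right algebra_simps inner_commute 1)
  then show ?thesis
    by (simp add: linear_rrr_def y_def power2_norm_eq_inner)
qed

text \<open>By \<open>linear_rrr_inner\<close> the squared norm drops by \<open>h * (2 - h)\<close>
  times the squared norm of \<open>L x\<close>. For \<open>h \<le> 1\<close> the factor
  \<open>2 - h\<close> is at least 1, and \<open>1 - s \<le> (1 - s / 2)\<^sup>2\<close> removes the
  squares.\<close>

lemma linear_rrr_contraction:
  assumes P: "orthogonal_projector S P" and Q: "orthogonal_projector T Q"
    and h: "0 \<le> h" "h \<le> 1" and c: "0 \<le> c" "c * norm x \<le> norm (linear_rrr P Q x)"
  shows "norm (x + h *\<^sub>R linear_rrr P Q x) \<le> (1 - h * c\<^sup>2 / 2) * norm x"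
proof -
  let ?L = "linear_rrr P Q x"
  have *: "(norm (x + h *\<^sub>R ?L))\<^sup>2 = (norm x)\<^sup>2 - h * (2 - h) * (norm ?L)\<^sup>2"
  proof -
    have "(norm (x + h *\<^sub>R ?L))\<^sup>2 = x \<bullet> x + 2 * h * (?L \<bullet> x) + h * h * (?L \<bullet> ?L)"
      by (simp add: power2_norm_eq_inner inner_add_left inner_add_right inner_commute algebra_simps)
    also have "\<dots> = (norm x)\<^sup>2 - h * (2 - h) * (norm ?L)\<^sup>2"
      unfolding linear_rrr_inner[OF P Q] dot_square_norm by (simp add: algebra_simps power2_eq_square)
    finally show ?thesis .
  qed
  have "h * 1 * (c * norm x)\<^sup>2 \<le> h * (2 - h) * (norm ?L)\<^sup>2"
    using h c by (intro mult_mono power_mono mult_left_mono) auto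
  with * have sq: "(norm (x + h *\<^sub>R ?L))\<^sup>2 \<le> (1 - h * c\<^sup>2) * (norm x)\<^sup>2"
    by (simp add: algebra_simps power_mult_distrib)
  show ?thesis
  proof (cases "x = 0")
    case True
    have "?L \<bullet> ?L = 0" using linear_rrr_inner[OF P Q, of x] True by (simp add: dot_square_norm)
    with True show ?thesis by simp
  next
    case False
    \<comment> \<open>The bound \<open>sq\<close> itself forces \<open>h * c\<^sup>2 \<le> 1\<close>
      for nonzero \<open>x\<close>; this makes the claimed right-hand side nonnegative, so that
      square roots can be compared.\<close>
    have "0 \<le> (1 - h * c\<^sup>2) * (norm x)\<^sup>2"
      using sq by (meson order_trans zero_le_power2)
    with False have nn: "0 \<le> 1 - h * c\<^sup>2" by (simp add: zero_le_mult_iff)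
    have "1 - h * c\<^sup>2 \<le> (1 - h * c\<^sup>2 / 2)\<^sup>2"
      using zero_le_power2[of "h * c\<^sup>2"] by (simp add: power2_diff algebra_simps)
    then have "(1 - h * c\<^sup>2) * (norm x)\<^sup>2 \<le> ((1 - h * c\<^sup>2 / 2) * norm x)\<^sup>2"
      by (simp add: power_mult_distrib mult_right_mono)
    with sq have "(norm (x + h *\<^sub>R ?L))\<^sup>2 \<le> ((1 - h * c\<^sup>2 / 2) * norm x)\<^sup>2" by linarith
    then show ?thesis
      by (rule power2_le_imp_le) (use nn in simp)
  qed
qed

text \<open>For \<open>m\<close> normal to \<open>S\<close> and \<open>n\<close> normal to
  \<open>T\<close>, the map \<open>(m, n) \<mapsto> L (m + n)\<close> is injective by
  transversality, hence bounded below in finite dimension. Almost normal vectors are reduced to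
  their normal parts, and the tangential remainders cost only a fraction of the bound.\<close>

lemma linear_rrr_bounded_below:
  fixes S T :: "'a::euclidean_space set"
  assumes S: "subspace S" and T: "subspace T"
    and P: "orthogonal_projector S P" and Q: "orthogonal_projector T Q"
    and sum: "{u + w | u w. u \<in> S \<and> w \<in> T} = UNIV"
  obtains c \<eta> where "0 < c" "0 < \<eta>"
    "\<And>m n. \<lbrakk>norm (P m) \<le> \<eta> * norm m; norm (Q n) \<le> \<eta> * norm n\<rbrakk> \<Longrightarrow>
       c * norm (m + n) \<le> norm (linear_rrr P Q (m + n))"
proof -
  let ?L = "linear_rrr P Q"
  note linP = orthogonal_projector_linear[OF P] and linQ = orthogonal_projector_linear[OF Q]
  have linL: "linear ?L" using linP linQ by (rule linear_linear_rrr)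
  define N where "N = {m. P m = 0} \<times> {n. Q n = 0}"
  define f where "f z = ?L (fst z + snd z)" for z
  have "linear (\<lambda>z::'a \<times> 'a. fst z + snd z)"
    by (intro linear_compose_add linear_fst linear_snd)
  from linear_compose[OF this linL] have linf: "linear f"
    by (simp add: o_def f_def[abs_def])
  have subN: "subspace N"
    unfolding N_def by (intro subspace_Times linear_subspace_kernel linP linQ)
  \<comment> \<open>Transversality in dual form: the normal spaces of \<open>S\<close> and
    \<open>T\<close> meet only in 0.\<close>
  have orth0: "x = 0" if "\<And>s. s \<in> S \<Longrightarrow> x \<bullet> s = 0" "\<And>t. t \<in> T \<Longrightarrow> x \<bullet> t = 0" for x
  proof -
    obtain u w where uw: "x = u + w" "u \<in> S" "w \<in> T" using sum by blast
    have "x \<bullet> x = x \<bullet> u + x \<bullet> w" using uw(1) inner_add_right by metis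
    then show ?thesis using that uw by simp
  qed
  have inj: "z = 0" if "z \<in> N" "f z = 0" for z
  proof -
    obtain m n where z: "z = (m, n)" by fastforce
    have mn: "P m = 0" "Q n = 0" using that(1) by (auto simp: N_def z)
    define w where "w = m + n"
    have eq: "Q (2 *\<^sub>R P w - w) = P w"
      using that(2) by (simp add: f_def z w_def linear_rrr_def)
    \<comment> \<open>By \<open>eq\<close> the vector \<open>P w\<close> lies in both
      \<open>S\<close> and \<open>T\<close>. As \<open>m\<close> is normal to \<open>S\<close> and
      \<open>n\<close> to \<open>T\<close>, \<open>w\<close> is orthogonal to \<open>P w\<close>, so
      \<open>P w = 0\<close> and then \<open>Q w = 0\<close>. Thus \<open>w\<close> is normal to
      both spaces and vanishes, and \<open>m = - n\<close> is normal to both as well.\<close>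
    have PwT: "P w \<in> T" using orthogonal_projector_mem[OF Q, of "2 *\<^sub>R P w - w"] eq by simp
    have PwS: "P w \<in> S" using orthogonal_projector_mem[OF P] .
    have "P w \<bullet> P w = w \<bullet> P w"
      using orthogonal_projector_inner[OF P PwS] .
    also have "\<dots> = 0"
      using orthogonal_projector_zeroD[OF P mn(1) PwS] orthogonal_projector_zeroD[OF Q mn(2) PwT]
      by (simp add: w_def inner_add_left)
    finally have Pw: "P w = 0" by simp
    then have Qw: "Q w = 0" using eq linear_neg[OF linQ, of w] by simp
    have "w = 0"
      using orthogonal_projector_zeroD[OF P Pw] orthogonal_projector_zeroD[OF Q Qw] orth0 by blast
    then have n: "n = - m" by (simp add: w_def eq_neg_iff_add_eq_0 add.commute)
    then have "Q m = 0" using mn(2) linear_neg[OF linQ, of m] by simp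
    then have "m = 0"
      using orthogonal_projector_zeroD[OF P mn(1)] orthogonal_projector_zeroD[OF Q] orth0 by blast
    with n z show ?thesis by (simp add: zero_prod_def)
  qed
  obtain e where e: "e > 0" "\<And>z. z \<in> N \<Longrightarrow> e * norm z \<le> norm (f z)"
    using injective_imp_isometric[OF closed_subspace[OF subN] subN linear_conv_bounded_linear[THEN iffD1, OF linf]]
      inj by metis
  obtain K where K: "K > 0" "\<And>x. norm (?L x) \<le> K * norm x"
    using linear_bounded_pos[OF linL] by metis
  \<comment> \<open>The value \<open>1 / 2\<close> leaves at least half of each vector in its normal
    part; \<open>e / (16 * K)\<close> keeps the image of the tangential parts well below the lower
    bound \<open>lo\<close>.\<close>
  define \<eta> where "\<eta> = min (1 / 2) (e / (16 * K))"
  have \<eta>: "0 < \<eta>" "\<eta> \<le> 1 / 2" "\<eta> * K \<le> e / 16"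
    using e(1) K(1) by (auto simp: \<eta>_def min_def field_simps)
  show ?thesis
  proof (rule that[of "e / 8" \<eta>])
    fix m n assume m: "norm (P m) \<le> \<eta> * norm m" and n: "norm (Q n) \<le> \<eta> * norm n"
    let ?m = "m - P m" and ?n = "n - Q n"
    have "(?m, ?n) \<in> N"
      by (simp add: N_def linear_diff[OF linP] linear_diff[OF linQ]
          orthogonal_projector_idem[OF P S] orthogonal_projector_idem[OF Q T])
    from e(2)[OF this] have lower: "e * norm (?m, ?n) \<le> norm (?L (?m + ?n))"
      by (simp add: f_def)
    have "norm ?m \<ge> norm m / 2" "norm ?n \<ge> norm n / 2"
      using m n mult_right_mono[OF \<eta>(2), of "norm m"] mult_right_mono[OF \<eta>(2), of "norm n"]
        norm_triangle_ineq2[of m "P m"] norm_triangle_ineq2[of n "Q n"] by auto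
    moreover have "norm ?m \<le> norm (?m, ?n)" "norm ?n \<le> norm (?m, ?n)"
      using norm_fst_le[of ?m ?n] norm_snd_le[of ?n ?m] by auto
    ultimately have "norm m / 2 + norm n / 2 \<le> norm (?m, ?n) + norm (?m, ?n)"
      by (meson add_mono order_trans)
    then have "(norm m + norm n) / 4 \<le> norm (?m, ?n)" by argo
    then have "e * ((norm m + norm n) / 4) \<le> norm (?L (?m + ?n))"
      using e(1) by (intro order_trans[OF mult_left_mono lower]) auto
    then have lo: "e * (norm m + norm n) / 4 \<le> norm (?L (?m + ?n))" by simp
    have "?L (m + n) = ?L (?m + ?n) + ?L (P m + Q n)"
      by (simp add: linear_add[OF linL, symmetric] algebra_simps)
    then have "norm (?L (m + n)) \<ge> norm (?L (?m + ?n)) - norm (?L (P m + Q n))"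
      by (metis norm_diff_ineq)
    moreover have "norm (?L (P m + Q n)) \<le> e * (norm m + norm n) / 8"
    proof -
      have "norm (?L (P m + Q n)) \<le> K * (\<eta> * (norm m + norm n))"
        using m n norm_triangle_ineq[of "P m" "Q n"] K(1)
        by (intro order_trans[OF K(2)] mult_left_mono) (auto simp: algebra_simps)
      also have "\<dots> \<le> (e / 16) * (norm m + norm n)"
        using mult_right_mono[OF \<eta>(3), of "norm m + norm n"] by (simp add: algebra_simps)
      also have "\<dots> \<le> e * (norm m + norm n) / 8" using e(1) by simp
      finally show ?thesis .
    qed
    ultimately have "norm (?L (m + n)) \<ge> e / 8 * (norm m + norm n)"
      using lo by (simp add: field_simps)
    moreover have "e / 8 * norm (m + n) \<le> e / 8 * (norm m + norm n)"
      using e(1) by (intro mult_left_mono norm_triangle_ineq) simp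
    ultimately show "e / 8 * norm (m + n) \<le> norm (?L (m + n))" by linarith
  qed (use e \<eta> in auto)
qed

section \<open>Strict derivatives\<close>

text \<open>The strict Frechet derivative: both points vary near \<open>p\<close>. It compares
  values at two nearby points using the derivative at \<open>p\<close> alone, which suits metric
  projections.\<close>

definition strict_derivative_at ::
    "('a::real_normed_vector \<Rightarrow> 'b::real_normed_vector) \<Rightarrow> ('a \<Rightarrow> 'b) \<Rightarrow> 'a \<Rightarrow> bool"
  where "strict_derivative_at f L p \<longleftrightarrow> bounded_linear L \<and>
    (\<forall>e>0. \<exists>r>0. \<forall>x\<in>ball p r. \<forall>y\<in>ball p r. norm (f x - f y - L (x - y)) \<le> e * norm (x - y))"

lemma strict_derivative_at_lipschitz:
  assumes "strict_derivative_at f L p"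
  obtains r K where "0 < r" "0 < K"
    "\<And>x y. \<lbrakk>x \<in> ball p r; y \<in> ball p r\<rbrakk> \<Longrightarrow> norm (f x - f y) \<le> K * norm (x - y)"
proof -
  have "bounded_linear L" using assms unfolding strict_derivative_at_def by blast
  then obtain M where M: "0 < M" "\<And>x. norm (L x) \<le> norm x * M"
    using bounded_linear.pos_bounded by blast
  have "\<exists>r>0. \<forall>x\<in>ball p r. \<forall>y\<in>ball p r. norm (f x - f y - L (x - y)) \<le> 1 * norm (x - y)"
    using assms unfolding strict_derivative_at_def by (meson zero_less_one)
  then obtain r where r: "0 < r"
    "\<And>x y. \<lbrakk>x \<in> ball p r; y \<in> ball p r\<rbrakk> \<Longrightarrow> norm (f x - f y - L (x - y)) \<le> 1 * norm (x - y)"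
    by blast
  show ?thesis
  proof (rule that[OF r(1), of "M + 1"])
    fix x y assume xy: "x \<in> ball p r" "y \<in> ball p r"
    have "norm (f x - f y) \<le> norm (L (x - y)) + norm (f x - f y - L (x - y))"
      by (rule norm_triangle_sub)
    also have "\<dots> \<le> norm (x - y) * M + 1 * norm (x - y)"
      by (intro add_mono M r xy)
    finally show "norm (f x - f y) \<le> (M + 1) * norm (x - y)" by (simp add: algebra_simps)
  qed (use M in simp)
qed

lemma strict_derivative_at_compose:
  assumes f: "strict_derivative_at f F p" and g: "strict_derivative_at g G (f p)"
  shows "strict_derivative_at (\<lambda>x. g (f x)) (\<lambda>x. G (F x)) p"
  unfolding strict_derivative_at_def
proof (intro conjI allI impI)
  have F: "bounded_linear F" and G: "bounded_linear G"
    using f g unfolding strict_derivative_at_def by blast+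
  then show "bounded_linear (\<lambda>x. G (F x))" by (metis bounded_linear_compose)
  fix e :: real assume e: "0 < e"
  obtain r1 K where K: "0 < r1" "0 < K"
    "\<And>x y. \<lbrakk>x \<in> ball p r1; y \<in> ball p r1\<rbrakk> \<Longrightarrow> norm (f x - f y) \<le> K * norm (x - y)"
    using strict_derivative_at_lipschitz[OF f] by metis
  obtain M where M: "0 < M" "\<And>x. norm (G x) \<le> norm x * M"
    using bounded_linear.pos_bounded[OF G] by blast
  \<comment> \<open>Each map gets half of the error: the one of \<open>g\<close> is stretched by the
    Lipschitz constant \<open>K\<close> of \<open>f\<close>, the one of \<open>f\<close> by the norm
    bound \<open>M\<close> of \<open>G\<close>.\<close>
  have "0 < e / (2 * M)" "0 < e / (2 * K)" using e M K by auto
  then obtain r2 r3 where r2: "0 < r2" "\<And>x y. \<lbrakk>x \<in> ball p r2; y \<in> ball p r2\<rbrakk>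
      \<Longrightarrow> norm (f x - f y - F (x - y)) \<le> e / (2 * M) * norm (x - y)"
    and r3: "0 < r3" "\<And>x y. \<lbrakk>x \<in> ball (f p) r3; y \<in> ball (f p) r3\<rbrakk>
      \<Longrightarrow> norm (g x - g y - G (x - y)) \<le> e / (2 * K) * norm (x - y)"
    using f g unfolding strict_derivative_at_def by metis
  define r where "r = min (min r1 r2) (r3 / K)"
  have r: "0 < r" "r \<le> r1" "r \<le> r2"
    using K r2(1) r3(1) by (auto simp: r_def)
  have "r \<le> r3 / K" by (simp add: r_def)
  then have Kr: "K * r \<le> r3" using K(2) by (simp add: field_simps)
  have img: "f x \<in> ball (f p) r3" if "x \<in> ball p r" for x
  proof -
    have "norm (f x - f p) \<le> K * norm (x - p)"
      using that r K(1) by (intro K(3)) auto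
    also have "\<dots> < K * r"
      using that K(2) by (simp add: dist_norm norm_minus_commute)
    finally show ?thesis using Kr by (simp add: dist_norm norm_minus_commute)
  qed
  show "\<exists>r>0. \<forall>x\<in>ball p r. \<forall>y\<in>ball p r.
      norm (g (f x) - g (f y) - G (F (x - y))) \<le> e * norm (x - y)"
  proof (intro exI[of _ r] conjI ballI r)
    fix x y assume xy: "x \<in> ball p r" "y \<in> ball p r"
    have "g (f x) - g (f y) - G (F (x - y)) =
        (g (f x) - g (f y) - G (f x - f y)) + G (f x - f y - F (x - y))"
      using linear_diff[OF bounded_linear.linear[OF G]] by simp
    then have "norm (g (f x) - g (f y) - G (F (x - y))) \<le>
        norm (g (f x) - g (f y) - G (f x - f y)) + norm (G (f x - f y - F (x - y)))"
      by (metis norm_triangle_ineq)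
    also have "\<dots> \<le> e / (2 * K) * (K * norm (x - y)) + (e / (2 * M) * norm (x - y)) * M"
    proof (rule add_mono)
      have "norm (g (f x) - g (f y) - G (f x - f y)) \<le> e / (2 * K) * norm (f x - f y)"
        by (intro r3 img xy)
      also have "\<dots> \<le> e / (2 * K) * (K * norm (x - y))"
        using xy r e K(2) by (intro mult_left_mono K(3)) auto
      finally show "norm (g (f x) - g (f y) - G (f x - f y)) \<le> e / (2 * K) * (K * norm (x - y))" .
      show "norm (G (f x - f y - F (x - y))) \<le> (e / (2 * M) * norm (x - y)) * M"
        using xy r M(1) by (intro order_trans[OF M(2)] mult_right_mono r2) auto
    qed
    also have "\<dots> = e * norm (x - y)"
      using K(2) M(1) by (simp add: field_simps)
    finally show "norm (g (f x) - g (f y) - G (F (x - y))) \<le> e * norm (x - y)" .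
  qed
qed

lemma strict_derivative_at_diff:
  assumes f: "strict_derivative_at f F p" and g: "strict_derivative_at g G p"
  shows "strict_derivative_at (\<lambda>x. f x - g x) (\<lambda>x. F x - G x) p"
  unfolding strict_derivative_at_def
proof (intro conjI allI impI)
  show "bounded_linear (\<lambda>x. F x - G x)"
    using f g unfolding strict_derivative_at_def by (blast intro: bounded_linear_sub)
  fix e :: real assume "0 < e"
  then have "0 < e / 2" by simp
  then obtain r s where r: "0 < r" "\<And>x y. \<lbrakk>x \<in> ball p r; y \<in> ball p r\<rbrakk>
      \<Longrightarrow> norm (f x - f y - F (x - y)) \<le> e / 2 * norm (x - y)"
    and s: "0 < s" "\<And>x y. \<lbrakk>x \<in> ball p s; y \<in> ball p s\<rbrakk>
      \<Longrightarrow> norm (g x - g y - G (x - y)) \<le> e / 2 * norm (x - y)"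
    using f g unfolding strict_derivative_at_def by metis
  show "\<exists>r>0. \<forall>x\<in>ball p r. \<forall>y\<in>ball p r.
      norm (f x - g x - (f y - g y) - (F (x - y) - G (x - y))) \<le> e * norm (x - y)"
  proof (intro exI[of _ "min r s"] conjI ballI)
    fix x y assume xy: "x \<in> ball p (min r s)" "y \<in> ball p (min r s)"
    have "f x - g x - (f y - g y) - (F (x - y) - G (x - y)) =
        (f x - f y - F (x - y)) - (g x - g y - G (x - y))" by simp
    then have "norm (f x - g x - (f y - g y) - (F (x - y) - G (x - y))) \<le>
        norm (f x - f y - F (x - y)) + norm (g x - g y - G (x - y))"
      by (metis norm_triangle_ineq4)
    also have "\<dots> \<le> e / 2 * norm (x - y) + e / 2 * norm (x - y)"
      using xy by (intro add_mono r s) auto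
    finally show "norm (f x - g x - (f y - g y) - (F (x - y) - G (x - y))) \<le> e * norm (x - y)"
      by simp
  qed (use r s in auto)
qed

lemma strict_derivative_at_bounded_linear:
  assumes "bounded_linear L"
  shows "strict_derivative_at L L p"
  using assms unfolding strict_derivative_at_def
  by (auto simp: linear_diff[OF bounded_linear.linear] intro!: exI[of _ 1])

text \<open>Chain rule; since \<open>reflection A\<close> fixes \<open>p\<close>, the outer
  projection is also differentiated at \<open>p\<close>.\<close>

lemma strict_derivative_at_rrr_field:
  assumes P: "strict_derivative_at (closest_point A) P p"
    and Q: "strict_derivative_at (closest_point B) Q p" and p: "p \<in> A" "p \<in> B"
  shows "strict_derivative_at (rrr_field A B) (linear_rrr P Q) p"
proof -
  have 2: "strict_derivative_at (\<lambda>x. 2 *\<^sub>R closest_point A x) (\<lambda>x. 2 *\<^sub>R P x) p"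
    by (rule strict_derivative_at_compose[OF P
          strict_derivative_at_bounded_linear[OF bounded_linear_scaleR_right]])
  have R: "strict_derivative_at (reflection A) (\<lambda>x. 2 *\<^sub>R P x - x) p"
    unfolding reflection_def[abs_def]
    by (intro strict_derivative_at_diff 2 strict_derivative_at_bounded_linear bounded_linear_ident)
  have "reflection A p = p"
    using p by (simp add: reflection_def closest_point_self scaleR_2)
  with Q have "strict_derivative_at (closest_point B) Q (reflection A p)" by simp
  from strict_derivative_at_diff[OF strict_derivative_at_compose[OF R this] P] show ?thesis
    by (simp add: rrr_field_def[abs_def] linear_rrr_def[abs_def])
qed

text \<open>Continuity bounds the second derivative near \<open>p\<close>, so the mean value
  inequality makes \<open>f'\<close> Lipschitz there. Linearising \<open>f\<close> about
  \<open>p\<close> on a small ball, where \<open>f'\<close> has hardly moved, yields the strict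
  derivative.\<close>

lemma C2_on_derivative:
  assumes C2: "C2_on f W" and W: "open W" and p: "p \<in> W"
  obtains f' r C where "\<And>x. x \<in> W \<Longrightarrow> (f has_derivative blinfun_apply (f' x)) (at x)"
    "strict_derivative_at f (blinfun_apply (f' p)) p" "0 < r" "0 < C"
    "\<And>x y. \<lbrakk>x \<in> ball p r; y \<in> ball p r\<rbrakk> \<Longrightarrow> norm (f' x - f' y) \<le> C * norm (x - y)"
proof -
  from C2 obtain f' f'' where
    f': "\<And>x. x \<in> W \<Longrightarrow> (f has_derivative blinfun_apply (f' x)) (at x)" and
    f'': "\<And>x. x \<in> W \<Longrightarrow> (f' has_derivative blinfun_apply (f'' x)) (at x)" and
    cont: "continuous_on W f''"
    unfolding C2_on_def by blast
  have "isCont f'' p"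
    using cont W p by (simp add: continuous_on_eq_continuous_at)
  then obtain s where s: "0 < s" "\<And>x. dist x p < s \<Longrightarrow> dist (f'' x) (f'' p) < 1"
    unfolding continuous_at_eps_delta by (metis zero_less_one)
  obtain t where t: "0 < t" "ball p t \<subseteq> W"
    using W p open_contains_ball by blast
  define r where "r = min s t"
  have r: "0 < r" "ball p r \<subseteq> W" using s t by (auto simp: r_def)
  define C where "C = norm (f'' p) + 1"
  have C: "0 < C" by (simp add: C_def add_nonneg_pos)
  have lip: "norm (f' x - f' y) \<le> C * norm (x - y)" if "x \<in> ball p r" "y \<in> ball p r" for x y
  proof (rule differentiable_bound[OF convex_ball _ _ that])
    fix z assume z: "z \<in> ball p r"
    then show "(f' has_derivative blinfun_apply (f'' z)) (at z within ball p r)"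
      using r(2) by (blast intro: has_derivative_at_withinI[OF f''])
    have "dist (f'' z) (f'' p) < 1" using z by (intro s) (auto simp: r_def dist_commute)
    then show "onorm (blinfun_apply (f'' z)) \<le> C"
      using norm_triangle_sub[of "f'' z" "f'' p"]
      by (simp add: C_def norm_blinfun.rep_eq[symmetric] dist_norm)
  qed
  have "strict_derivative_at f (blinfun_apply (f' p)) p"
    unfolding strict_derivative_at_def
  proof (intro conjI allI impI)
    fix e :: real assume e: "0 < e"
    define u where "u = min r (e / C)"
    have u: "0 < u" "u \<le> r" "C * u \<le> e" using r C e by (auto simp: u_def min_def field_simps)
    show "\<exists>r>0. \<forall>x\<in>ball p r. \<forall>y\<in>ball p r.
        norm (f x - f y - blinfun_apply (f' p) (x - y)) \<le> e * norm (x - y)"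
    proof (intro exI[of _ u] conjI ballI u)
      fix x y assume xy: "x \<in> ball p u" "y \<in> ball p u"
      have "norm (f x - f y - blinfun_apply (f' p) (x - y)) \<le> norm (x - y) * e"
      proof (rule differentiable_bound_linearization[of y x "ball p u" f "\<lambda>z. blinfun_apply (f' z)" p])
        show "y + t *\<^sub>R (x - y) \<in> ball p u" if "t \<in> {0..1}" for t
          using convexD_alt[OF convex_ball xy(2,1), of t] that by (simp add: algebra_simps)
        show "(f has_derivative blinfun_apply (f' z)) (at z within ball p u)" if "z \<in> ball p u" for z
        proof (rule has_derivative_at_withinI[OF f'])
          show "z \<in> W" using that u(2) r(2) by auto
        qed
        show "onorm (blinfun_apply (f' z) - blinfun_apply (f' p)) \<le> e" if "z \<in> ball p u" for z
        proof -
          have "norm (f' z - f' p) \<le> C * norm (z - p)"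
            using that u by (intro lip) auto
          also have "\<dots> \<le> C * u"
            using that C by (simp add: dist_norm norm_minus_commute)
          finally show ?thesis
            using u(3) by (simp add: norm_blinfun.rep_eq minus_blinfun.rep_eq fun_diff_def)
        qed
      qed (use u in auto)
      then show "norm (f x - f y - blinfun_apply (f' p) (x - y)) \<le> e * norm (x - y)"
        by (simp add: mult.commute)
    qed
  qed (rule blinfun.bounded_linear_right)
  with that f' r(1) C lip show ?thesis by metis
qed

lemma derivative_left_inverse:
  assumes "open W" "p \<in> W" "\<And>x. x \<in> W \<Longrightarrow> g (f x) = x"
    and f: "(f has_derivative F) (at p)" and g: "(g has_derivative G) (at (f p))"
  shows "G (F u) = u"
proof -
  have "((\<lambda>x. g (f x)) has_derivative (\<lambda>x. G (F x))) (at p)"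
    using f g by (rule has_derivative_compose)
  then have "((\<lambda>x. x) has_derivative (\<lambda>x. G (F x))) (at p)"
    by (rule has_derivative_transform_within_open[OF _ assms(1,2)]) (use assms(3) in auto)
  then have "(\<lambda>x. G (F x)) = (\<lambda>x. x)"
    using has_derivative_ident has_derivative_unique by blast
  then show ?thesis by metis
qed

section \<open>The metric projection onto a submanifold\<close>

text \<open>\<open>T\<close> is the image of the chart plane \<open>V\<close> under the derivative
  of the inverse chart at \<open>q = \<phi> p\<close>. For feet \<open>a\<close>, \<open>b\<close>
  of \<open>x\<close>, \<open>y\<close>, the chord \<open>a - b\<close> is almost in
  \<open>T\<close>, while the difference of the residuals \<open>x - a\<close> and
  \<open>y - b\<close> is almost normal to \<open>T\<close>; projecting \<open>x - y\<close>
  therefore nearly returns \<open>a - b\<close>. The inclusion of \<open>tangent_space A p\<close>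
  in \<open>T\<close> carries transversality over to these spaces.\<close>

lemma C2_submanifold_closest_point:
  fixes A :: "'a::euclidean_space set"
  assumes clo: "closed A" and C2: "C2_submanifold A" and pA: "p \<in> A"
  obtains T P where "subspace T" "tangent_space A p \<subseteq> T" "orthogonal_projector T P"
    "strict_derivative_at (closest_point A) P p"
proof -
  obtain W W' \<phi> \<psi> V where pW: "p \<in> W" and diffeo: "C2_diffeomorphism W W' \<phi> \<psi>"
    and V: "subspace V" and chart: "\<phi> ` (A \<inter> W) = V \<inter> W'"
    using C2 pA unfolding C2_submanifold_def by blast
  have op: "open W" "open W'" and hom: "homeomorphism W W' \<phi> \<psi>"
    and C2s: "C2_on \<phi> W" "C2_on \<psi> W'"
    using diffeo unfolding C2_diffeomorphism_def by auto
  have inv: "\<And>x. x \<in> W \<Longrightarrow> \<psi> (\<phi> x) = x" "\<And>y. y \<in> W' \<Longrightarrow> \<phi> (\<psi> y) = y"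
    and im: "\<phi> ` W = W'" "\<psi> ` W' = W"
    using hom unfolding homeomorphism_def by auto
  have chartD: "\<phi> x \<in> V" if "x \<in> A" "x \<in> W" for x using chart that by blast
  have chartI: "\<psi> y \<in> A" if "y \<in> V" "y \<in> W'" for y
  proof -
    have "y \<in> \<phi> ` (A \<inter> W)" using chart that by simp
    then show ?thesis using inv(1) by auto
  qed
  define q where "q = \<phi> p"
  have q: "q \<in> W'" "q \<in> V" "\<psi> q = p"
    using pW pA im inv chartD by (auto simp: q_def)
  obtain \<phi>' r0 C0 where \<phi>': "\<And>x. x \<in> W \<Longrightarrow> (\<phi> has_derivative blinfun_apply (\<phi>' x)) (at x)"
    "strict_derivative_at \<phi> (blinfun_apply (\<phi>' p)) p"
    using C2_on_derivative[OF C2s(1) op(1) pW] by metis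
  obtain \<psi>' r1 C where \<psi>': "\<And>x. x \<in> W' \<Longrightarrow> (\<psi> has_derivative blinfun_apply (\<psi>' x)) (at x)"
    "strict_derivative_at \<psi> (blinfun_apply (\<psi>' q)) q" "0 < r1" "0 < C"
    "\<And>x y. \<lbrakk>x \<in> ball q r1; y \<in> ball q r1\<rbrakk> \<Longrightarrow> norm (\<psi>' x - \<psi>' y) \<le> C * norm (x - y)"
    using C2_on_derivative[OF C2s(2) op(2) q(1)] by metis
  define D where "D = blinfun_apply (\<psi>' q)"
  define E where "E = blinfun_apply (\<phi>' p)"
  have linD: "linear D" unfolding D_def by (rule blinfun.bounded_linear_right[THEN bounded_linear.linear])
  have DE: "D (E u) = u" for u
    unfolding D_def E_def
    by (rule derivative_left_inverse[OF op(1) pW inv(1) \<phi>'(1)[OF pW]])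
      (use \<psi>'(1)[OF q(1)] q_def in auto)
  have ED: "E (D u) = u" for u
    unfolding D_def E_def
    by (rule derivative_left_inverse[OF op(2) q(1) inv(2) \<psi>'(1)[OF q(1)]])
      (use \<phi>'(1)[OF pW] q(3) in auto)
  define T where "T = D ` V"
  have T: "subspace T" unfolding T_def using linD V by (rule linear_subspace_image)
  have ET: "E t \<in> V" if "t \<in> T" for t using that ED by (auto simp: T_def)
  \<comment> \<open>In the chart a curve in \<open>A\<close> through \<open>p\<close> runs inside
    \<open>V\<close>, so its difference quotients at 0 and, \<open>V\<close> being closed, their
    limit \<open>E u\<close> lie in \<open>V\<close>.\<close>
  have tangent: "tangent_space A p \<subseteq> T"
  proof
    fix u assume "u \<in> tangent_space A p"
    then obtain \<gamma> and e :: real where \<gamma>: "0 < e" "\<gamma> ` {-e<..<e} \<subseteq> A" "\<gamma> 0 = p"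
      "(\<gamma> has_vector_derivative u) (at 0)"
      unfolding tangent_space_def by blast
    have "((\<lambda>t. \<phi> (\<gamma> t)) has_vector_derivative E u) (at 0)"
      using has_derivative_compose[OF \<gamma>(4)[unfolded has_vector_derivative_def], of \<phi> "blinfun_apply (\<phi>' p)"]
        \<phi>'(1)[OF pW] \<gamma>(3)
      by (simp add: has_vector_derivative_def E_def blinfun.scaleR_right)
    then have "((\<lambda>t. norm (\<phi> (\<gamma> t) - \<phi> (\<gamma> 0) - t *\<^sub>R E u) / norm t) \<longlongrightarrow> 0) (at 0)"
      by (simp add: has_vector_derivative_def has_derivative_iff_norm)
    moreover have "\<forall>\<^sub>F t in at (0::real). norm (\<phi> (\<gamma> t) - \<phi> (\<gamma> 0) - t *\<^sub>R E u) / norm t =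
        norm ((\<phi> (\<gamma> t) - \<phi> (\<gamma> 0)) /\<^sub>R t - E u)"
    proof (rule eventually_mono[OF eventually_neq_at_within[of 0]])
      fix t :: real assume t: "t \<noteq> 0"
      then have "(\<phi> (\<gamma> t) - \<phi> (\<gamma> 0)) /\<^sub>R t - E u =
          (\<phi> (\<gamma> t) - \<phi> (\<gamma> 0) - t *\<^sub>R E u) /\<^sub>R t"
        by (simp add: scaleR_diff_right)
      then show "norm (\<phi> (\<gamma> t) - \<phi> (\<gamma> 0) - t *\<^sub>R E u) / norm t =
          norm ((\<phi> (\<gamma> t) - \<phi> (\<gamma> 0)) /\<^sub>R t - E u)"
        by (simp add: divide_inverse mult.commute)
    qed
    ultimately have "((\<lambda>t. norm ((\<phi> (\<gamma> t) - \<phi> (\<gamma> 0)) /\<^sub>R t - E u)) \<longlongrightarrow> 0) (at 0)"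
      by (rule Lim_transform_eventually)
    then have lim: "((\<lambda>t. (\<phi> (\<gamma> t) - \<phi> (\<gamma> 0)) /\<^sub>R t) \<longlongrightarrow> E u) (at 0)"
      by (simp add: tendsto_norm_zero_iff LIM_zero_iff)
    have "isCont \<gamma> 0"
      using \<gamma>(4) by (rule has_vector_derivative_continuous)
    then have "\<forall>\<^sub>F t in at 0. \<gamma> t \<in> W"
      using op(1) pW \<gamma>(3) by (auto simp: isCont_def intro: topological_tendstoD)
    moreover have "\<forall>\<^sub>F t in at 0. t \<in> {-e<..<e}"
      using \<gamma>(1) by (intro eventually_at_in_open') auto
    ultimately have "\<forall>\<^sub>F t in at 0. (\<phi> (\<gamma> t) - \<phi> (\<gamma> 0)) /\<^sub>R t \<in> V"
    proof eventually_elim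
      case (elim t)
      then have "\<phi> (\<gamma> t) \<in> V" using \<gamma>(2) chartD by blast
      then show ?case
        using V q by (simp add: \<gamma>(3) q_def[symmetric] subspace_diff subspace_scale)
    qed
    then have "E u \<in> V"
      using Lim_in_closed_set[OF closed_subspace[OF V] _ _ lim] by simp
    then show "u \<in> T" using DE unfolding T_def by (metis image_eqI)
  qed
  obtain P where P: "orthogonal_projector T P"
    using orthogonal_projector_exists[OF T] .
  have linP: "linear P" by (rule orthogonal_projector_linear[OF P])
  note cpA = closest_point_in_set[OF clo]
  have ne: "A \<noteq> {}" using pA by blast
  \<comment> \<open>First-order optimality: moving the foot along \<open>u\<close> inside
    \<open>V\<close> stays in \<open>A\<close> for small times, so the squared distance to
    \<open>x\<close> has a local minimum at time 0.\<close>
  have normal: "(x - closest_point A x) \<bullet> \<psi>' (\<phi> (closest_point A x)) u = 0"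
    if a: "closest_point A x \<in> W" and u: "u \<in> V" for x u
  proof -
    let ?a = "closest_point A x"
    define h where "h t = (x - \<psi> (\<phi> ?a + t *\<^sub>R u)) \<bullet> (x - \<psi> (\<phi> ?a + t *\<^sub>R u))" for t
    have aV: "\<phi> ?a \<in> V" using cpA[OF ne] a chartD by blast
    have aW: "\<phi> ?a \<in> W'" using a im by blast
    let ?g = "\<lambda>t. x - \<psi> (\<phi> ?a + t *\<^sub>R u)"
    have g: "(?g has_derivative (\<lambda>t. - \<psi>' (\<phi> ?a) (t *\<^sub>R u))) (at 0)"
    proof -
      have "((\<lambda>t. \<phi> ?a + t *\<^sub>R u) has_derivative (\<lambda>t. t *\<^sub>R u)) (at 0)"
        by (auto intro!: derivative_eq_intros)
      from has_derivative_compose[OF this, of \<psi> "blinfun_apply (\<psi>' (\<phi> ?a))"] \<psi>'(1)[OF aW]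
      have "((\<lambda>t. \<psi> (\<phi> ?a + t *\<^sub>R u)) has_derivative (\<lambda>t. \<psi>' (\<phi> ?a) (t *\<^sub>R u))) (at 0)"
        by simp
      from has_derivative_diff[OF has_derivative_const this] show ?thesis by simp
    qed
    have "(h has_derivative (\<lambda>t. ?g 0 \<bullet> (- \<psi>' (\<phi> ?a) (t *\<^sub>R u)) + (- \<psi>' (\<phi> ?a) (t *\<^sub>R u)) \<bullet> ?g 0)) (at 0)"
      unfolding h_def[abs_def] by (rule has_derivative_inner[OF g g])
    then have der: "(h has_real_derivative - 2 * ((x - ?a) \<bullet> \<psi>' (\<phi> ?a) u)) (at 0)"
      unfolding has_field_derivative_def
      by (rule has_derivative_eq_rhs)
        (auto simp: inv(1)[OF a] blinfun.scaleR_right inner_commute)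
    have "((\<lambda>t. \<phi> ?a + t *\<^sub>R u) \<longlongrightarrow> \<phi> ?a + 0 *\<^sub>R u) (nhds (0::real))"
      by (intro tendsto_intros filterlim_ident)
    then have "\<forall>\<^sub>F t in nhds 0. \<phi> ?a + t *\<^sub>R u \<in> W'"
      using op(2) aW by (auto intro: topological_tendstoD)
    then obtain d where d: "0 < d" "\<And>t. dist t 0 < d \<Longrightarrow> \<phi> ?a + t *\<^sub>R u \<in> W'"
      unfolding eventually_nhds_metric by blast
    have "- 2 * ((x - ?a) \<bullet> \<psi>' (\<phi> ?a) u) = 0"
    proof (rule DERIV_local_min[OF der d(1)], intro allI impI)
      fix t :: real assume "\<bar>0 - t\<bar> < d"
      then have "\<psi> (\<phi> ?a + t *\<^sub>R u) \<in> A"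
        using d(2)[of t] aV u V by (intro chartI) (auto simp: subspace_add subspace_scale)
      from closest_point_le[OF clo this, of x]
      have "norm (x - ?a) \<le> norm (x - \<psi> (\<phi> ?a + t *\<^sub>R u))" by (simp add: dist_norm)
      then show "h 0 \<le> h t"
        by (simp add: h_def inv(1)[OF a] dot_square_norm)
    qed
    then show ?thesis by simp
  qed
  have "strict_derivative_at (closest_point A) P p"
    unfolding strict_derivative_at_def
  proof (intro conjI allI impI)
    show "bounded_linear P" using linP by (simp add: linear_conv_bounded_linear)
    fix e :: real assume e: "0 < e"
    \<comment> \<open>The estimate below ends in
      \<open>\<zeta> * (norm (a - b) + norm (x - y))\<close>. The bound \<open>1 / 2\<close> lets
      \<open>norm (a - b)\<close> be absorbed, giving
      \<open>norm (a - b) \<le> 3 * norm (x - y)\<close>; then \<open>4 * \<zeta> \<le> e\<close>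
      finishes.\<close>
    define \<zeta> where "\<zeta> = min (1 / 2) (e / 4)"
    have \<zeta>: "0 < \<zeta>" "\<zeta> \<le> 1 / 2" "4 * \<zeta> \<le> e" using e by (auto simp: \<zeta>_def)
    obtain r2 K where K: "0 < r2" "0 < K"
      "\<And>x y. \<lbrakk>x \<in> ball p r2; y \<in> ball p r2\<rbrakk> \<Longrightarrow> norm (\<phi> x - \<phi> y) \<le> K * norm (x - y)"
      using strict_derivative_at_lipschitz[OF \<phi>'(2)] by metis
    obtain M where M: "0 < M" "\<And>x. norm (E x) \<le> M * norm x"
      using linear_bounded_pos[of E] blinfun.bounded_linear_right[THEN bounded_linear.linear]
      unfolding E_def by metis
    obtain r3 where r3: "0 < r3" "\<And>x y. \<lbrakk>x \<in> ball q r3; y \<in> ball q r3\<rbrakk>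
        \<Longrightarrow> norm (\<psi> x - \<psi> y - D (x - y)) \<le> \<zeta> / (2 * K) * norm (x - y)"
      using \<psi>'(2) \<zeta>(1) K(2) unfolding strict_derivative_at_def D_def
      by (metis divide_pos_pos mult_pos_pos zero_less_numeral)
    obtain r4 where r4: "0 < r4" "ball p r4 \<subseteq> W"
      using op(1) pW open_contains_ball by blast
    \<comment> \<open>Feet of points of \<open>ball p r\<close> lie in
      \<open>ball p (2 * r)\<close>, their chart images in \<open>ball q (2 * K * r)\<close>. The
      first four entries fit these balls into the domains of the estimates; the last makes the
      variation of the tangent spaces small against \<open>\<zeta>\<close>.\<close>
    define r where "r = Min {r2 / 2, r4 / 2, r1 / (2 * K), r3 / (2 * K), \<zeta> / (8 * C * K * M)}"
    have rpos: "0 < r" using K \<psi>' r3 r4 \<zeta> M by (simp add: r_def)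
    have "r \<le> r2 / 2" "r \<le> r4 / 2" "r \<le> r1 / (2 * K)" "r \<le> r3 / (2 * K)" "r \<le> \<zeta> / (8 * C * K * M)"
      unfolding r_def by (rule Min_le; simp)+
    then have r: "2 * r \<le> r2" "2 * r \<le> r4" "2 * K * r \<le> r1" "2 * K * r \<le> r3" "8 * C * K * M * r \<le> \<zeta>"
      using K \<psi>'(4) M by (auto simp: field_simps)
    have cp: "closest_point A x \<in> ball p (2 * r)" if "x \<in> ball p r" for x
    proof -
      have "dist x (closest_point A x) \<le> dist x p" by (rule closest_point_le[OF clo pA])
      with that dist_triangle[of p "closest_point A x" x] show ?thesis
        by (simp add: dist_commute)
    qed
    have \<phi>cp: "\<phi> a \<in> ball q (2 * K * r)" if "a \<in> ball p (2 * r)" for a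
    proof -
      have "norm (\<phi> a - \<phi> p) \<le> K * norm (a - p)"
        using that r K(1) by (intro K(3)) auto
      also have "\<dots> < K * (2 * r)"
        using that K(2) by (simp add: dist_norm norm_minus_commute)
      finally show ?thesis by (simp add: dist_norm norm_minus_commute q_def)
    qed
    show "\<exists>r>0. \<forall>x\<in>ball p r. \<forall>y\<in>ball p r.
        norm (closest_point A x - closest_point A y - P (x - y)) \<le> e * norm (x - y)"
    proof (intro exI[of _ r] conjI ballI rpos)
      fix x y assume xy: "x \<in> ball p r" "y \<in> ball p r"
      define a b where "a = closest_point A x" and "b = closest_point A y"
      define m n where "m = x - a" and "n = y - b"
      have ab: "a \<in> ball p (2 * r)" "b \<in> ball p (2 * r)"
        using cp xy by (auto simp: a_def b_def)
      then have abW: "a \<in> W" "b \<in> W" using r(2) r4(2) by auto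
      have abA: "a \<in> A" "b \<in> A" using cpA[OF ne] by (auto simp: a_def b_def)
      have abV: "\<phi> a - \<phi> b \<in> V" using abA abW chartD V by (simp add: subspace_diff)
      note \<phi>ab = \<phi>cp[OF ab(1)] \<phi>cp[OF ab(2)]
      have \<phi>lip: "norm (\<phi> a - \<phi> b) \<le> K * norm (a - b)"
        using ab r(1) by (intro K(3)) auto
      have n_le: "norm n \<le> r"
        using closest_point_le[OF clo pA, of y] xy(2) by (simp add: n_def b_def dist_norm norm_minus_commute)
      \<comment> \<open>The chord is nearly tangent: \<open>D (\<phi> a - \<phi> b)\<close> lies in
        \<open>T\<close>, and \<open>P (a - b)\<close> is at least as close to
        \<open>a - b\<close>.\<close>
      have 1: "norm (a - b - P (a - b)) \<le> \<zeta> / 2 * norm (a - b)"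
      proof -
        have "norm (a - b - P (a - b)) \<le> norm (a - b - D (\<phi> a - \<phi> b))"
          using abV by (intro orthogonal_projector_closest[OF P T]) (simp add: T_def)
        also have "\<dots> \<le> \<zeta> / (2 * K) * norm (\<phi> a - \<phi> b)"
          using r3(2)[of "\<phi> a" "\<phi> b"] \<phi>ab r(4) by (simp add: inv abW)
        also have "\<dots> \<le> \<zeta> / (2 * K) * (K * norm (a - b))"
          using \<zeta> K(2) by (intro mult_left_mono \<phi>lip) auto
        finally show ?thesis using K(2) by simp
      qed
      \<comment> \<open>The residual difference is nearly normal. Inserting the optimality
        conditions at \<open>a\<close> and \<open>b\<close> leaves only differences of
        \<open>\<psi>'\<close>: one of size \<open>r\<close> paired with \<open>m - n\<close>, one
        of size \<open>norm (a - b)\<close> paired with \<open>n\<close>, whose norm is at most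
        \<open>r\<close>. Both terms are thus small relative to
        \<open>norm (m - n) + norm (a - b)\<close>.\<close>
      have 2: "norm (P (m - n)) \<le> \<zeta> / 4 * (norm (m - n) + norm (a - b))"
      proof (cases "P (m - n) = 0")
        case False
        define w where "w = P (m - n)"
        have wT: "w \<in> T" unfolding w_def by (rule orthogonal_projector_mem[OF P])
        have eq: "(norm w)\<^sup>2 =
            (m - n) \<bullet> (\<psi>' q - \<psi>' (\<phi> a)) (E w) + n \<bullet> (\<psi>' (\<phi> b) - \<psi>' (\<phi> a)) (E w)"
        proof -
          have "(norm w)\<^sup>2 = (m - n) \<bullet> w"
            unfolding w_def by (rule orthogonal_projector_norm_sq[OF P])
          also have "\<dots> = (m - n) \<bullet> \<psi>' q (E w)"
            using DE[of w] by (simp add: D_def)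
          finally show ?thesis
            using normal[of x "E w"] normal[of y "E w"] abW ET[OF wT]
            by (simp add: m_def n_def a_def[symmetric] b_def[symmetric] minus_blinfun.rep_eq
                inner_diff_left inner_diff_right)
        qed
        have Ew: "norm (E w) \<le> M * norm w" by (rule M(2))
        have d1: "norm (\<psi>' q - \<psi>' (\<phi> a)) \<le> C * (2 * K * r)"
          using \<psi>'(5)[of q "\<phi> a"] \<phi>ab(1) r(3) \<psi>'(3,4)
          by (intro order_trans[OF \<psi>'(5)] mult_left_mono) (auto simp: dist_norm)
        have d2: "norm (\<psi>' (\<phi> b) - \<psi>' (\<phi> a)) \<le> C * (K * norm (a - b))"
          using \<phi>ab r(3) \<psi>'(4) \<phi>lip
          by (intro order_trans[OF \<psi>'(5)] mult_left_mono) (auto simp: norm_minus_commute)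
        have "(norm w)\<^sup>2 \<le> norm (m - n) * (C * (2 * K * r) * (M * norm w))
            + r * (C * (K * norm (a - b)) * (M * norm w))"
          unfolding eq
        proof (rule add_mono)
          show "(m - n) \<bullet> (\<psi>' q - \<psi>' (\<phi> a)) (E w) \<le> norm (m - n) * (C * (2 * K * r) * (M * norm w))"
            using d1 Ew \<psi>'(4) K(2) rpos
            by (intro order_trans[OF norm_cauchy_schwarz] mult_left_mono
                order_trans[OF norm_blinfun] mult_mono) simp_all
          show "n \<bullet> (\<psi>' (\<phi> b) - \<psi>' (\<phi> a)) (E w) \<le> r * (C * (K * norm (a - b)) * (M * norm w))"
            using d2 Ew n_le rpos \<psi>'(4) K(2)
            by (intro order_trans[OF norm_cauchy_schwarz] mult_mono
                order_trans[OF norm_blinfun] mult_mono) simp_all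
        qed
        also have "\<dots> = (C * K * M * r) * (2 * norm (m - n) + norm (a - b)) * norm w"
          by (simp add: algebra_simps)
        finally have "norm w \<le> (C * K * M * r) * (2 * norm (m - n) + norm (a - b))"
          using False by (simp add: power2_eq_square w_def)
        also have "\<dots> \<le> (\<zeta> / 8) * (2 * (norm (m - n) + norm (a - b)))"
          using r(5) \<zeta>(1) by (intro mult_mono) auto
        finally show ?thesis by (simp add: w_def algebra_simps)
      qed (use \<zeta> in simp)
      have "m - n = (x - y) - (a - b)" by (simp add: m_def n_def)
      then have mn: "norm (m - n) \<le> norm (x - y) + norm (a - b)" and
        "P (x - y) = P (m - n) + P (a - b)"
        by (simp_all add: norm_triangle_ineq4 linear_diff[OF linP])
      then have "a - b - P (x - y) = (a - b - P (a - b)) - P (m - n)" by simp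
      then have "norm (a - b - P (x - y)) \<le> norm (a - b - P (a - b)) + norm (P (m - n))"
        by (metis norm_triangle_ineq4)
      also have "\<dots> \<le> \<zeta> / 2 * norm (a - b) + \<zeta> / 4 * (norm (m - n) + norm (a - b))"
        by (rule add_mono[OF 1 2])
      also have "\<dots> \<le> \<zeta> / 2 * norm (a - b) + \<zeta> / 4 * ((norm (x - y) + norm (a - b)) + norm (a - b))"
        using mn \<zeta>(1) by (intro add_left_mono mult_left_mono add_right_mono) auto
      also have "\<dots> \<le> \<zeta> * (norm (a - b) + norm (x - y))"
        using mult_nonneg_nonneg[of \<zeta> "norm (x - y)"] \<zeta>(1) by (simp add: field_simps)
      finally have 3: "norm (a - b - P (x - y)) \<le> \<zeta> * (norm (a - b) + norm (x - y))" .
      have "norm (a - b) \<le> norm (P (x - y)) + norm (a - b - P (x - y))"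
        by (rule norm_triangle_sub)
      also have "\<dots> \<le> norm (x - y) + 1 / 2 * (norm (a - b) + norm (x - y))"
        using \<zeta>(2) by (intro add_mono orthogonal_projector_norm_le[OF P]
            order_trans[OF 3] mult_right_mono) auto
      finally have "norm (a - b) \<le> 3 * norm (x - y)" by (simp add: field_simps)
      then have "\<zeta> * (norm (a - b) + norm (x - y)) \<le> \<zeta> * (4 * norm (x - y))"
        using \<zeta>(1) by (intro mult_left_mono) auto
      also have "\<dots> \<le> e * norm (x - y)"
        using mult_right_mono[OF \<zeta>(3), of "norm (x - y)"] by (simp add: algebra_simps)
      finally show "norm (closest_point A x - closest_point A y - P (x - y)) \<le> e * norm (x - y)"
        using 3 by (simp add: a_def b_def)
    qed
  qed
  with that T tangent P show ?thesis by blast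
qed

section \<open>Contraction of the RRR field near a transversal point\<close>

lemma dist_closest_point_le_twice:
  assumes "closed A" "p \<in> A"
  shows "dist p (closest_point A x) \<le> 2 * dist p x"
  using closest_point_le[OF assms, of x] dist_triangle[of p "closest_point A x" x]
  by (simp add: dist_commute)

text \<open>The linearised step contracts \<open>v x\<close> by
  \<open>1 - h * c\<^sup>2 / 2\<close>, and strict differentiability bounds the linearisation error
  by \<open>c\<^sup>2 / 4 * h * norm (v x)\<close>. Half of the contraction survives, so
  \<open>\<kappa>\<close> is \<open>c\<^sup>2 / 4\<close>, capped at 1.\<close>

lemma rrr_field_contraction:
  fixes A B :: "'a::euclidean_space set"
  assumes clo: "closed A" "closed B" and C2: "C2_submanifold A" "C2_submanifold B"
    and trans: "transversal_at A B p"
  obtains r \<kappa> K where "0 < r" "0 < \<kappa>" "\<kappa> \<le> 1" "0 < K"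
    "\<And>x y. \<lbrakk>x \<in> cball p r; y \<in> cball p r\<rbrakk>
      \<Longrightarrow> norm (rrr_field A B x - rrr_field A B y) \<le> K * norm (x - y)"
    "\<And>x h. \<lbrakk>x \<in> cball p r; 0 \<le> h; h \<le> 1; x + h *\<^sub>R rrr_field A B x \<in> cball p r\<rbrakk>
      \<Longrightarrow> norm (rrr_field A B (x + h *\<^sub>R rrr_field A B x)) \<le> (1 - \<kappa> * h) * norm (rrr_field A B x)"
proof -
  let ?v = "rrr_field A B"
  have p: "p \<in> A" "p \<in> B" using trans unfolding transversal_at_def by auto
  obtain S P where S: "subspace S" "tangent_space A p \<subseteq> S" "orthogonal_projector S P"
    "strict_derivative_at (closest_point A) P p"
    using C2_submanifold_closest_point[OF clo(1) C2(1) p(1)] .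
  obtain T Q where T: "subspace T" "tangent_space B p \<subseteq> T" "orthogonal_projector T Q"
    "strict_derivative_at (closest_point B) Q p"
    using C2_submanifold_closest_point[OF clo(2) C2(2) p(2)] .
  have sum: "{u + w | u w. u \<in> S \<and> w \<in> T} = UNIV"
    using trans S(2) T(2) unfolding transversal_at_def by blast
  let ?L = "linear_rrr P Q"
  have linL: "linear ?L"
    using S(3) T(3) by (intro linear_linear_rrr orthogonal_projector_linear)
  obtain c \<eta> where c: "0 < c" "0 < \<eta>"
    "\<And>m n. \<lbrakk>norm (P m) \<le> \<eta> * norm m; norm (Q n) \<le> \<eta> * norm n\<rbrakk> \<Longrightarrow>
       c * norm (m + n) \<le> norm (?L (m + n))"
    using linear_rrr_bounded_below[OF S(1) T(1) S(3) T(3) sum] by metis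
  have strict: "strict_derivative_at ?v ?L p"
    by (rule strict_derivative_at_rrr_field[OF S(4) T(4) p])
  obtain r1 K where K: "0 < r1" "0 < K"
    "\<And>x y. \<lbrakk>x \<in> ball p r1; y \<in> ball p r1\<rbrakk> \<Longrightarrow> norm (?v x - ?v y) \<le> K * norm (x - y)"
    using strict_derivative_at_lipschitz[OF strict] by metis
  have "0 < c\<^sup>2 / 4" using c(1) by simp
  then obtain r2 where r2: "0 < r2" "\<And>x y. \<lbrakk>x \<in> ball p r2; y \<in> ball p r2\<rbrakk>
      \<Longrightarrow> norm (?v x - ?v y - ?L (x - y)) \<le> c\<^sup>2 / 4 * norm (x - y)"
    using strict unfolding strict_derivative_at_def by metis
  obtain r3 where r3: "0 < r3" "\<And>x y. \<lbrakk>x \<in> ball p r3; y \<in> ball p r3\<rbrakk>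
      \<Longrightarrow> norm (closest_point A x - closest_point A y - P (x - y)) \<le> \<eta> * norm (x - y)"
    using S(4) c(2) unfolding strict_derivative_at_def by metis
  obtain r4 where r4: "0 < r4" "\<And>x y. \<lbrakk>x \<in> ball p r4; y \<in> ball p r4\<rbrakk>
      \<Longrightarrow> norm (closest_point B x - closest_point B y - Q (x - y)) \<le> \<eta> * norm (x - y)"
    using T(4) c(2) unfolding strict_derivative_at_def by metis
  \<comment> \<open>For \<open>x\<close> within \<open>r\<close> of \<open>p\<close>, the foot
    \<open>a\<close> is within \<open>2 * r\<close>, the reflected point \<open>y\<close> within
    \<open>5 * r\<close> and its foot \<open>b\<close> within \<open>10 * r\<close>; the divisors
    leave room for strict inequalities.\<close>
  define r where "r = Min {r1 / 2, r2 / 2, r3 / 3, r4 / 11}"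
  have r0: "0 < r" using K(1) r2(1) r3(1) r4(1) by (simp add: r_def)
  have "r \<le> r1 / 2" "r \<le> r2 / 2" "r \<le> r3 / 3" "r \<le> r4 / 11"
    unfolding r_def by (rule Min_le; simp)+
  with r0 have r: "r < r1" "r < r2" "2 * r < r3" "10 * r < r4" by auto
  have Lv: "c * norm (?v x) \<le> norm (?L (?v x))" if x: "x \<in> cball p r" for x
  proof -
    define a y b where "a = closest_point A x" and "y = 2 *\<^sub>R a - x" and "b = closest_point B y"
    have a: "dist p a \<le> 2 * r"
      using dist_closest_point_le_twice[OF clo(1) p(1), of x] x by (simp add: a_def)
    have "y - p = 2 *\<^sub>R (a - p) - (x - p)" by (simp add: y_def algebra_simps scaleR_2)
    then have "norm (y - p) \<le> norm (2 *\<^sub>R (a - p)) + norm (x - p)"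
      by (metis norm_triangle_ineq4)
    then have y: "dist p y \<le> 5 * r"
      using a x by (simp add: dist_norm norm_minus_commute)
    have b: "dist p b \<le> 10 * r"
      using dist_closest_point_le_twice[OF clo(2) p(2), of y] y by (simp add: b_def)
    have aa: "closest_point A a = a"
      unfolding a_def using closest_point_in_set[OF clo(1)] p(1) by (intro closest_point_self) auto
    have bb: "closest_point B b = b"
      unfolding b_def using closest_point_in_set[OF clo(2)] p(2) by (intro closest_point_self) auto
    \<comment> \<open>Both \<open>x\<close> and \<open>a\<close> project to \<open>a\<close>, so the
      strict derivative estimate for this pair says that \<open>P (x - a)\<close> is small, that is,
      \<open>x - a\<close> is almost normal.\<close>
    have "norm (P (x - a)) \<le> \<eta> * norm (x - a)"
      using r3(2)[of x a] x a r r0 by (simp add: aa a_def[symmetric])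
    moreover have "norm (Q (y - b)) \<le> \<eta> * norm (y - b)"
      using r4(2)[of y b] y b r r0 by (simp add: bb b_def[symmetric])
    ultimately have "c * norm ((x - a) + (y - b)) \<le> norm (?L ((x - a) + (y - b)))"
      by (rule c(3))
    moreover have "(x - a) + (y - b) = - ?v x"
      by (simp add: rrr_field_def reflection_def a_def b_def y_def scaleR_2)
    ultimately show ?thesis by (simp add: linear_neg[OF linL])
  qed
  show ?thesis
  proof (rule that[of r "min 1 (c\<^sup>2 / 4)" K])
    show "norm (?v x - ?v y) \<le> K * norm (x - y)" if "x \<in> cball p r" "y \<in> cball p r" for x y
      using that r by (intro K(3)) auto
    fix x and h :: real
    assume x: "x \<in> cball p r" and h: "0 \<le> h" "h \<le> 1" and xh: "x + h *\<^sub>R ?v x \<in> cball p r"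
    let ?x = "x + h *\<^sub>R ?v x"
    have "norm (?v ?x) \<le> norm (?v x + h *\<^sub>R ?L (?v x)) + norm (?v ?x - (?v x + h *\<^sub>R ?L (?v x)))"
      by (rule norm_triangle_sub)
    also have "\<dots> \<le> (1 - h * c\<^sup>2 / 2) * norm (?v x) + c\<^sup>2 / 4 * (h * norm (?v x))"
    proof (rule add_mono)
      show "norm (?v x + h *\<^sub>R ?L (?v x)) \<le> (1 - h * c\<^sup>2 / 2) * norm (?v x)"
        using c(1) Lv[OF x] by (intro linear_rrr_contraction[OF S(3) T(3) h]) auto
      show "norm (?v ?x - (?v x + h *\<^sub>R ?L (?v x))) \<le> c\<^sup>2 / 4 * (h * norm (?v x))"
        using r2(2)[of ?x x] x xh r h by (simp add: linear_scale[OF linL] algebra_simps)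
    qed
    also have "\<dots> = (1 - c\<^sup>2 / 4 * h) * norm (?v x)"
      by (simp add: algebra_simps)
    also have "\<dots> \<le> (1 - min 1 (c\<^sup>2 / 4) * h) * norm (?v x)"
      using h by (intro mult_right_mono diff_left_mono) auto
    finally show "norm (?v ?x) \<le> (1 - min 1 (c\<^sup>2 / 4) * h) * norm (?v x)" .
  qed (use r0 c K in auto)
qed

section \<open>Bounded Lipschitz fields and the Euler scheme\<close>

text \<open>Derivatives are taken within \<open>S\<close>, hence one-sided at endpoints; for
  \<open>S = {0..}\<close> this is the differential equation in \<open>rrr_solution\<close>.\<close>

definition integral_curve_on :: "('a::real_normed_vector \<Rightarrow> 'a) \<Rightarrow> real set \<Rightarrow> (real \<Rightarrow> 'a) \<Rightarrow> bool"
  where "integral_curve_on v S x \<longleftrightarrow> (\<forall>t\<in>S. (x has_vector_derivative v (x t)) (at t within S))"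

definition euler :: "('a::real_vector \<Rightarrow> 'a) \<Rightarrow> real \<Rightarrow> 'a \<Rightarrow> nat \<Rightarrow> 'a"
  where "euler v h x k = ((\<lambda>x. x + h *\<^sub>R v x) ^^ k) x"

lemma euler_0 [simp]: "euler v h x 0 = x"
  and euler_Suc: "euler v h x (Suc k) = euler v h x k + h *\<^sub>R v (euler v h x k)"
  by (simp_all add: euler_def)

lemma integral_curve_on_subset:
  "integral_curve_on v S x \<Longrightarrow> S' \<subseteq> S \<Longrightarrow> integral_curve_on v S' x"
  unfolding integral_curve_on_def by (blast intro: has_vector_derivative_within_subset)

lemma integral_curve_on_cong:
  assumes "\<And>t. t \<in> S \<Longrightarrow> v (x t) = w (x t)"
  shows "integral_curve_on v S x \<longleftrightarrow> integral_curve_on w S x"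
  unfolding integral_curve_on_def using assms by simp

lemma integral_curve_on_continuous: "integral_curve_on v S x \<Longrightarrow> continuous_on S x"
  unfolding integral_curve_on_def
  by (meson continuous_on_eq_continuous_within has_vector_derivative_continuous)

lemma integral_curve_on_shift:
  assumes "integral_curve_on v {0..} x" "0 \<le> s"
  shows "integral_curve_on v {0..} (\<lambda>t. x (s + t))"
  unfolding integral_curve_on_def
proof
  fix t :: real assume t: "t \<in> {0..}"
  have im: "(+) s ` {0..} \<subseteq> {0..}" using assms(2) by auto
  have "(x has_vector_derivative v (x (s + t))) (at (s + t) within (+) s ` {0..})"
    using assms t im unfolding integral_curve_on_def
    by (meson atLeast_iff add_nonneg_nonneg has_vector_derivative_within_subset)
  moreover have "((+) s has_vector_derivative 1) (at t within {0..})"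
    by (auto intro!: derivative_eq_intros)
  ultimately show "((\<lambda>t. x (s + t)) has_vector_derivative v (x (s + t))) (at t within {0..})"
    using vector_diff_chain_within[of "(+) s" 1 t "{0..}" x "v (x (s + t))"]
    by (simp add: o_def)
qed

section \<open>Global existence, Euler error and uniqueness\<close>

locale bounded_lipschitz_field =
  fixes w :: "'a::euclidean_space \<Rightarrow> 'a" and K M :: real
  assumes K: "0 < K" and lipschitz: "norm (w x - w y) \<le> K * norm (x - y)"
    and bound: "norm (w x) \<le> M"
begin

lemma M_nonneg: "0 \<le> M"
  using bound norm_ge_zero order_trans by blast

lemma continuous_on_field: "continuous_on S w"
  using lipschitz K by (intro lipschitz_on_continuous_on[of K]) (auto simp: lipschitz_on_def dist_norm)

text \<open>Picard iteration in an exponentially weighted supremum norm: the weight makes the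
  integral operator a contraction on the whole half-line, so one fixed point gives a global
  solution.\<close>

lemma integral_curve_exists: "\<exists>x. x 0 = x0 \<and> integral_curve_on w {0..} x"
proof -
  \<comment> \<open>The curve is written as \<open>x0 + exp (2 * K * t) *\<^sub>R f t\<close> with
    \<open>f\<close> bounded and continuous, and \<open>H\<close> is the Picard operator in terms of
    \<open>f\<close>. Bounded continuous functions live on the whole line, so \<open>max 0 t\<close>
    extends \<open>H f\<close> constantly to negative times.\<close>
  define g where "g f s = w (x0 + exp (2 * K * s) *\<^sub>R apply_bcontfun f s)" for f :: "real \<Rightarrow>\<^sub>C 'a" and s
  define G where "G f t = integral {0..t} (g f)" for f t
  define H where "H f t = exp (- (2 * K * max 0 t)) *\<^sub>R G f (max 0 t)" for f t
  have contg: "continuous_on S (g f)" for S f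
    unfolding g_def by (rule continuous_on_compose2[OF continuous_on_field[of UNIV]])
      (auto intro!: continuous_intros)
  have intg: "g f integrable_on {s..t}" for f s t
    by (rule integrable_continuous_real[OF contg])
  have Glip: "norm (G f t - G f s) \<le> M * (t - s)" if "0 \<le> s" "s \<le> t" for f s t
  proof -
    have "G f t - G f s = integral {s..t} (g f)"
      using Henstock_Kurzweil_Integration.integral_combine[OF that intg] by (simp add: G_def algebra_simps)
    then show ?thesis
      using integral_bound[OF that(2) contg, of f M] bound by (simp add: g_def)
  qed
  have "M-lipschitz_on {0..} (G f)" for f
  proof (rule lipschitz_onI)
    fix s t :: real assume st: "s \<in> {0..}" "t \<in> {0..}"
    show "dist (G f s) (G f t) \<le> M * dist s t"
      using Glip[of s t f] Glip[of t s f] st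
      by (cases "s \<le> t") (auto simp: dist_norm norm_minus_commute)
  qed (rule M_nonneg)
  then have contG: "continuous_on {0..} (G f)" for f by (rule lipschitz_on_continuous_on)
  have contH: "continuous_on UNIV (H f)" for f
    unfolding H_def
    by (intro continuous_intros continuous_on_compose2[OF contG]) auto
  have boundH: "norm (H f t) \<le> M / (2 * K)" for f t
  proof -
    define u where "u = max 0 t"
    have u: "0 \<le> u" by (simp add: u_def)
    have "norm (H f t) \<le> exp (- (2 * K * u)) * (M * u)"
      using Glip[of 0 u f] u by (simp add: H_def u_def[symmetric] G_def)
    also have "\<dots> \<le> M / (2 * K)"
    proof -
      have "2 * K * u \<le> exp (2 * K * u)"
        using exp_ge_add_one_self[of "2 * K * u"] by linarith
      from mult_left_mono[OF this M_nonneg] show ?thesis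
        using K by (simp add: exp_minus field_simps)
    qed
    finally show ?thesis .
  qed
  define F where "F f = Bcontfun (H f)" for f
  have F: "apply_bcontfun (F f) = H f" for f
    unfolding F_def by (intro Bcontfun_inverse bcontfun_normI[OF contH boundH])
  have contraction: "dist (F f1) (F f2) \<le> 1 / 2 * dist f1 f2" for f1 f2
  proof (rule dist_bound)
    fix t :: real
    define u where "u = max 0 t"
    have u: "0 \<le> u" by (simp add: u_def)
    let ?d = "dist f1 f2"
    \<comment> \<open>The weight grows at twice the Lipschitz rate, so integrating
      \<open>K * exp (2 * K * s)\<close> produces the contraction factor
      \<open>1 / 2\<close>.\<close>
    have "((\<lambda>s. ?d / 2 * exp (2 * K * s)) has_vector_derivative K * exp (2 * K * s) * ?d)
        (at s within {0..u})" for s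
      by (auto intro!: derivative_eq_intros simp: has_real_derivative_iff_has_vector_derivative[symmetric])
    then have int: "((\<lambda>s. K * exp (2 * K * s) * ?d) has_integral
        (?d / 2 * exp (2 * K * u) - ?d / 2 * exp (2 * K * 0))) {0..u}"
      by (intro fundamental_theorem_of_calculus u) auto
    have "norm (G f1 u - G f2 u) = norm (integral {0..u} (\<lambda>s. g f1 s - g f2 s))"
      unfolding G_def by (simp add: integral_diff[OF intg intg])
    also have "\<dots> \<le> integral {0..u} (\<lambda>s. K * exp (2 * K * s) * ?d)"
    proof (rule integral_norm_bound_integral)
      show "(\<lambda>s. g f1 s - g f2 s) integrable_on {0..u}" by (intro integrable_diff intg)
      show "(\<lambda>s. K * exp (2 * K * s) * ?d) integrable_on {0..u}" using int by blast
      fix s assume "s \<in> {0..u}"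
      have "norm (g f1 s - g f2 s) \<le> K * norm (exp (2 * K * s) *\<^sub>R (f1 s - f2 s))"
        unfolding g_def by (rule order_trans[OF lipschitz]) (simp add: scaleR_diff_right)
      also have "\<dots> = K * exp (2 * K * s) * dist (f1 s) (f2 s)" by (simp add: dist_norm)
      also have "\<dots> \<le> K * exp (2 * K * s) * ?d"
        using K by (intro mult_left_mono dist_bounded) auto
      finally show "norm (g f1 s - g f2 s) \<le> K * exp (2 * K * s) * ?d" .
    qed
    also have "\<dots> \<le> ?d / 2 * exp (2 * K * u)"
      using integral_unique[OF int] by simp
    finally have "exp (- (2 * K * u)) * norm (G f1 u - G f2 u)
        \<le> exp (- (2 * K * u)) * (?d / 2 * exp (2 * K * u))"
      by (rule mult_left_mono) simp
    also have "\<dots> = 1 / 2 * ?d" by (simp add: exp_minus)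
    finally show "dist (F f1 t) (F f2 t) \<le> 1 / 2 * ?d"
      by (simp add: F H_def u_def dist_norm flip: scaleR_diff_right)
  qed
  then obtain f where f: "F f = f"
    using banach_fix_type[of "1 / 2" F] by auto
  define x where "x t = x0 + exp (2 * K * t) *\<^sub>R apply_bcontfun f t" for t
  have x: "x t = x0 + G f t" if "0 \<le> t" for t
  proof -
    have "apply_bcontfun f t = exp (- (2 * K * t)) *\<^sub>R G f t"
      using F[of f] that by (simp add: f H_def)
    then show ?thesis by (simp add: x_def exp_minus)
  qed
  have "(x has_vector_derivative w (x t)) (at t within {0..})" if t: "0 \<le> t" for t
  proof -
    \<comment> \<open>The compact interval reaches past \<open>t\<close>, so near \<open>t\<close>
      it coincides with the half-line.\<close>
    have "(G f has_vector_derivative g f t) (at t within {0..t + 1})"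
      unfolding G_def by (rule integral_has_vector_derivative[OF contg]) (use t in auto)
    moreover have "at t within {0..t + 1} = at t within {0..}"
      by (rule at_within_nhd[of _ "{..<t + 1}"]) auto
    ultimately have "((\<lambda>t. x0 + G f t) has_vector_derivative g f t) (at t within {0..})"
      by (auto intro!: derivative_eq_intros)
    then have "(x has_vector_derivative g f t) (at t within {0..})"
      by (rule has_vector_derivative_transform[rotated 2]) (use t x in auto)
    then show ?thesis by (simp add: g_def x_def)
  qed
  moreover have "x 0 = x0" using x[of 0] by (simp add: G_def)
  ultimately show ?thesis unfolding integral_curve_on_def by auto
qed

text \<open>During the step the curve moves by at most \<open>M * h\<close>, so the field changes by
  at most \<open>K * M * h\<close>; the mean value inequality does the rest.\<close>

lemma integral_curve_local_error:
  assumes x: "integral_curve_on w {0..\<tau>} x" and s: "0 \<le> s" "0 \<le> h" "s + h \<le> \<tau>"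
  shows "norm (x (s + h) - x s - h *\<^sub>R w (x s)) \<le> K * M * h\<^sup>2"
proof -
  have der: "(x has_vector_derivative w (x u)) (at u within {s..s + h})" if "u \<in> {s..s + h}" for u
    using integral_curve_on_subset[OF x, of "{s..s + h}"] that s
    unfolding integral_curve_on_def by auto
  have lip: "norm (x u - x s) \<le> M * h" if u: "u \<in> {s..s + h}" for u
  proof -
    have "norm (x u - x s) \<le> M * norm (u - s)"
    proof (rule differentiable_bound[of "{s..s + h}" x "\<lambda>u d. d *\<^sub>R w (x u)" M])
      show "(x has_derivative (\<lambda>d. d *\<^sub>R w (x u))) (at u within {s..s + h})"
        if "u \<in> {s..s + h}" for u
        using der[OF that] unfolding has_vector_derivative_def .
      show "onorm (\<lambda>d. d *\<^sub>R w (x u)) \<le> M" for u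
        using bound[of "x u"] M_nonneg
        by (intro onorm_le) (simp add: mult.commute[of M] mult_left_mono)
    qed (use u s in auto)
    also have "\<dots> \<le> M * h" using u M_nonneg by (intro mult_left_mono) auto
    finally show ?thesis .
  qed
  have "norm (x (s + h) - x s - ((s + h) - s) *\<^sub>R w (x s)) \<le> norm ((s + h) - s) * (K * (M * h))"
  proof (rule vector_differentiable_bound_linearization[OF der])
    show "closed_segment s (s + h) \<subseteq> {s..s + h}" using s by (simp add: closed_segment_eq_real_ivl)
    show "norm (w (x u) - w (x s)) \<le> K * (M * h)" if "u \<in> {s..s + h}" for u
      using lip[OF that] K by (intro order_trans[OF lipschitz] mult_left_mono) auto
  qed (use s in auto)
  then show ?thesis using s by (simp add: power2_eq_square algebra_simps)
qed

text \<open>Discrete Gronwall: each step multiplies the error by at most \<open>1 + K * h\<close>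
  and adds \<open>K * M * h\<^sup>2\<close>. The quantity
  \<open>M * h * ((1 + K * h) ^ k - 1)\<close> solves this recursion exactly.\<close>

lemma euler_error:
  assumes x: "integral_curve_on w {0..\<tau>} x" and h: "0 \<le> h" and k: "real k * h \<le> \<tau>"
  shows "norm (euler w h (x 0) k - x (real k * h)) \<le> M * h * exp (K * (real k * h))"
proof -
  have "norm (euler w h (x 0) k - x (real k * h)) \<le> M * h * ((1 + K * h) ^ k - 1)"
    using k
  proof (induction k)
    case (Suc k)
    let ?e = "euler w h (x 0) k" and ?t = "real k * h"
    have t: "real (Suc k) * h = ?t + h" by (simp add: algebra_simps)
    have \<tau>: "?t + h \<le> \<tau>" "?t \<le> \<tau>" using Suc.prems h unfolding t by auto
    have IH: "norm (?e - x ?t) \<le> M * h * ((1 + K * h) ^ k - 1)"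
      by (rule Suc.IH[OF \<tau>(2)])
    have "norm (x (?t + h) - x ?t - h *\<^sub>R w (x ?t)) \<le> K * M * h\<^sup>2"
      using h \<tau> by (intro integral_curve_local_error[OF x]) auto
    moreover have "norm (h *\<^sub>R (w ?e - w (x ?t))) \<le> h * (K * norm (?e - x ?t))"
      using h lipschitz[of ?e "x ?t"] by (simp add: mult_left_mono)
    moreover have "euler w h (x 0) (Suc k) - x (?t + h) =
        (?e - x ?t) + h *\<^sub>R (w ?e - w (x ?t)) - (x (?t + h) - x ?t - h *\<^sub>R w (x ?t))"
      by (simp add: euler_Suc algebra_simps)
    then have "norm (euler w h (x 0) (Suc k) - x (?t + h)) \<le>
        norm (?e - x ?t) + norm (h *\<^sub>R (w ?e - w (x ?t))) + norm (x (?t + h) - x ?t - h *\<^sub>R w (x ?t))"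
      by (simp only:) (rule order_trans[OF norm_triangle_ineq4 add_right_mono[OF norm_triangle_ineq]])
    ultimately have "norm (euler w h (x 0) (Suc k) - x (?t + h)) \<le>
        (1 + K * h) * norm (?e - x ?t) + K * M * h\<^sup>2"
      by (simp add: algebra_simps)
    also have "\<dots> \<le> (1 + K * h) * (M * h * ((1 + K * h) ^ k - 1)) + K * M * h\<^sup>2"
      using IH K h by (intro add_right_mono mult_left_mono) auto
    also have "\<dots> = M * h * ((1 + K * h) ^ Suc k - 1)"
      by (simp add: algebra_simps power2_eq_square)
    finally show ?case unfolding t .
  qed simp
  also have "\<dots> \<le> M * h * exp (K * (real k * h))"
  proof (intro mult_left_mono)
    have "(1 + K * h) ^ k \<le> exp (K * h) ^ k"
      using K h by (intro power_mono exp_ge_add_one_self) auto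
    also have "\<dots> = exp (K * (real k * h))"
      by (simp add: exp_of_nat_mult[symmetric] algebra_simps)
    finally show "(1 + K * h) ^ k - 1 \<le> exp (K * (real k * h))" by simp
  qed (use M_nonneg h in auto)
  finally show ?thesis .
qed

text \<open>\<open>Suc n\<close> equal steps end exactly at \<open>\<tau>\<close>. Through this
  limit, closed conditions pass from Euler orbits to curves, and curves with the same start
  coincide.\<close>

lemma euler_tendsto_integral_curve:
  assumes x: "integral_curve_on w {0..\<tau>} x" and \<tau>: "0 \<le> \<tau>"
  shows "(\<lambda>n. euler w (\<tau> / Suc n) (x 0) (Suc n)) \<longlonglongrightarrow> x \<tau>"
proof (rule LIM_zero_cancel, rule Lim_null_comparison)
  show "\<forall>\<^sub>F n in sequentially. norm (euler w (\<tau> / Suc n) (x 0) (Suc n) - x \<tau>)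
      \<le> M * (\<tau> / Suc n) * exp (K * \<tau>)"
  proof (rule always_eventually, rule allI)
    fix n
    show "norm (euler w (\<tau> / Suc n) (x 0) (Suc n) - x \<tau>) \<le> M * (\<tau> / Suc n) * exp (K * \<tau>)"
      using euler_error[OF x, of "\<tau> / Suc n" "Suc n"] \<tau> by (simp del: of_nat_Suc)
  qed
  have "(\<lambda>n. M * (\<tau> * inverse (Suc n)) * exp (K * \<tau>)) \<longlonglongrightarrow> M * (\<tau> * 0) * exp (K * \<tau>)"
    by (intro tendsto_intros LIMSEQ_inverse_real_of_nat)
  then show "(\<lambda>n. M * (\<tau> / Suc n) * exp (K * \<tau>)) \<longlonglongrightarrow> 0"
    by (simp add: divide_inverse)
qed

lemma integral_curve_unique:
  assumes "integral_curve_on w {0..\<tau>} x" "integral_curve_on w {0..\<tau>} y" "x 0 = y 0" "0 \<le> \<tau>"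
  shows "x \<tau> = y \<tau>"
  using euler_tendsto_integral_curve[OF assms(1,4)] euler_tendsto_integral_curve[OF assms(2,4)]
    assms(3) LIMSEQ_unique by metis

end

section \<open>Contracting fields\<close>

text \<open>The conclusions of \<open>rrr_field_contraction\<close> as axioms; the dynamics below
  use only these and the zero at \<open>p\<close>.\<close>

locale contracting_field =
  fixes v :: "'a::euclidean_space \<Rightarrow> 'a" and p :: 'a and r \<kappa> K :: real
  assumes r: "0 < r" and \<kappa>: "0 < \<kappa>" "\<kappa> \<le> 1" and K: "0 < K"
    and zero: "v p = 0"
    and lipschitz: "\<lbrakk>x \<in> cball p r; y \<in> cball p r\<rbrakk> \<Longrightarrow> norm (v x - v y) \<le> K * norm (x - y)"
    and contraction: "\<lbrakk>x \<in> cball p r; 0 \<le> h; h \<le> 1; x + h *\<^sub>R v x \<in> cball p r\<rbrakk>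
      \<Longrightarrow> norm (v (x + h *\<^sub>R v x)) \<le> (1 - \<kappa> * h) * norm (v x)"
begin

text \<open>A step of length \<open>h * norm (v x)\<close> raises the first term by at most that
  amount, while contraction lowers the second by at least as much.\<close>

definition energy :: "'a \<Rightarrow> real"
  where "energy x = dist p x + norm (v x) / \<kappa>"

text \<open>Contraction at rate \<open>\<kappa>\<close> bounds the remaining path length by
  \<open>norm (v x) / \<kappa>\<close>, so orbits from here cannot reach the boundary of the
  ball.\<close>

definition basin :: "'a set"
  where "basin = {x \<in> ball p r. energy x < r}"

text \<open>Composing with the nonexpansive projection onto the ball gives a globally Lipschitz,
  bounded field that agrees with \<open>v\<close> on the ball, so the global theory applies to
  it.\<close>

definition clamped :: "'a \<Rightarrow> 'a"
  where "clamped x = v (closest_point (cball p r) x)"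

lemma clamped_eq: "x \<in> cball p r \<Longrightarrow> clamped x = v x"
  by (simp add: clamped_def closest_point_self)

sublocale clamped: bounded_lipschitz_field clamped K "K * r"
proof
  have mem: "closest_point (cball p r) x \<in> cball p r" for x
    using r by (intro closest_point_in_set) auto
  show "norm (clamped x - clamped y) \<le> K * norm (x - y)" for x y
  proof -
    have "dist (closest_point (cball p r) x) (closest_point (cball p r) y) \<le> dist x y"
      using r by (intro closest_point_lipschitz) auto
    then have "K * norm (closest_point (cball p r) x - closest_point (cball p r) y) \<le> K * norm (x - y)"
      using K by (simp add: dist_norm)
    then show ?thesis
      unfolding clamped_def using lipschitz[OF mem mem] order_trans by blast
  qed
  show "norm (clamped x) \<le> K * r" for x
  proof -
    have "norm (v (closest_point (cball p r) x) - v p) \<le> K * norm (closest_point (cball p r) x - p)"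
      using r by (intro lipschitz mem) auto
    also have "\<dots> \<le> K * r"
      using K mem[of x] by (intro mult_left_mono) (auto simp: dist_norm norm_minus_commute)
    finally show ?thesis by (simp add: clamped_def zero)
  qed
qed (rule K)

lemma basin_subset: "x \<in> basin \<Longrightarrow> x \<in> cball p r"
  by (simp add: basin_def)

lemma clamped_basin: "x \<in> basin \<Longrightarrow> clamped x = v x"
  by (simp add: clamped_eq basin_def)

lemma center_in_basin: "p \<in> basin"
  using r by (simp add: basin_def energy_def zero)

lemma open_basin: "open basin"
proof -
  have "continuous_on (ball p r) (\<lambda>x. dist p x + norm (clamped x) / \<kappa>)"
    using \<kappa> by (intro continuous_intros clamped.continuous_on_field) auto
  then have "continuous_on (ball p r) energy"
    by (rule continuous_on_eq) (simp add: energy_def clamped_eq)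
  from continuous_open_preimage[OF this open_ball open_lessThan[of r]]
  show ?thesis by (simp add: basin_def vimage_def Int_def)
qed

lemma norm_le_basin:
  assumes "x \<in> basin"
  shows "norm (v x) \<le> \<kappa> * r"
proof -
  have "dist p x + norm (v x) / \<kappa> < r" using assms by (simp add: basin_def energy_def)
  then have "norm (v x) / \<kappa> \<le> r" using zero_le_dist[of p x] by linarith
  then show ?thesis using \<kappa> by (simp add: field_simps)
qed

text \<open>The contraction axiom presupposes that the new point is in the ball. This comes first:
  \<open>\<kappa> * h \<le> 1\<close> bounds the displacement by
  \<open>norm (v x) / \<kappa>\<close>, so the new distance is at most
  \<open>energy x\<close>.\<close>

lemma basin_step:
  assumes x: "x \<in> basin" and h: "0 \<le> h" "h \<le> 1"
  shows "x + h *\<^sub>R v x \<in> basin"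
    and "energy (x + h *\<^sub>R v x) \<le> energy x"
    and "norm (v (x + h *\<^sub>R v x)) \<le> (1 - \<kappa> * h) * norm (v x)"
proof -
  let ?y = "x + h *\<^sub>R v x"
  have d: "dist p ?y \<le> dist p x + h * norm (v x)"
    using h dist_triangle[of p ?y x] by (simp add: dist_norm)
  have "\<kappa> * h * norm (v x) \<le> 1 * norm (v x)"
    using \<kappa> h by (intro mult_right_mono mult_le_one) auto
  then have "h * norm (v x) \<le> norm (v x) / \<kappa>" using \<kappa> by (simp add: field_simps)
  with d have "dist p ?y \<le> energy x" by (simp add: energy_def)
  with x have y: "?y \<in> ball p r" by (simp add: basin_def)
  show c: "norm (v ?y) \<le> (1 - \<kappa> * h) * norm (v x)"
    using basin_subset[OF x] h y by (intro contraction) auto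
  have "norm (v ?y) / \<kappa> \<le> (1 - \<kappa> * h) * norm (v x) / \<kappa>"
    using \<kappa> c by (intro divide_right_mono) auto
  also have "\<dots> = norm (v x) / \<kappa> - h * norm (v x)" using \<kappa> by (simp add: field_simps)
  finally show e: "energy ?y \<le> energy x" using d by (simp add: energy_def)
  show "?y \<in> basin" using y e x by (simp add: basin_def)
qed

lemma euler_basin:
  assumes x: "x \<in> basin" and h: "0 \<le> h" "h \<le> 1"
  shows "euler v h x k \<in> basin" and "energy (euler v h x k) \<le> energy x"
    and "norm (v (euler v h x k)) \<le> exp (- (\<kappa> * (real k * h))) * norm (v x)"
proof -
  have "euler v h x k \<in> basin \<and> energy (euler v h x k) \<le> energy x \<and>
    norm (v (euler v h x k)) \<le> exp (- (\<kappa> * (real k * h))) * norm (v x)"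
  proof (induction k)
    case 0
    then show ?case using x by simp
  next
    case (Suc k)
    let ?e = "euler v h x k"
    note step = basin_step[OF conjunct1[OF Suc] h]
    have "norm (v (?e + h *\<^sub>R v ?e)) \<le> (1 - \<kappa> * h) * norm (v ?e)" by (rule step(3))
    also have "\<dots> \<le> exp (- (\<kappa> * h)) * norm (v ?e)"
      using exp_ge_add_one_self[of "- (\<kappa> * h)"] by (intro mult_right_mono) auto
    also have "\<dots> \<le> exp (- (\<kappa> * h)) * (exp (- (\<kappa> * (real k * h))) * norm (v x))"
      using Suc by (intro mult_left_mono) auto
    also have "\<dots> = exp (- (\<kappa> * h) + - (\<kappa> * (real k * h))) * norm (v x)"
      by (simp only: exp_add mult.assoc)
    also have "\<dots> = exp (- (\<kappa> * (real (Suc k) * h))) * norm (v x)"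
      by (simp add: algebra_simps)
    finally show ?case using Suc step by (auto simp: euler_Suc)
  qed
  then show "euler v h x k \<in> basin" "energy (euler v h x k) \<le> energy x"
    "norm (v (euler v h x k)) \<le> exp (- (\<kappa> * (real k * h))) * norm (v x)" by auto
qed

section \<open>Passage from Euler orbits to integral curves\<close>

lemma euler_clamped:
  assumes "x \<in> basin" "0 \<le> h" "h \<le> 1"
  shows "euler clamped h x k = euler v h x k"
proof (induction k)
  case (Suc k)
  then show ?case
    using euler_basin(1)[OF assms, of k] by (simp add: euler_Suc clamped_basin)
qed simp

text \<open>Euler orbits ending at time \<open>\<tau>\<close> satisfy the energy and decay bounds,
  which pass to the limit. The strict inequality defining the basin survives because the energies
  stay below the fixed value \<open>energy (x 0) < r\<close>.\<close>

lemma clamped_curve: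
  assumes x: "integral_curve_on clamped {0..\<tau>} x" and x0: "x 0 \<in> basin" and \<tau>: "0 \<le> \<tau>"
  shows "x \<tau> \<in> basin" and "norm (v (x \<tau>)) \<le> exp (- (\<kappa> * \<tau>)) * norm (v (x 0))"
proof -
  define e where "e n = euler clamped (\<tau> / Suc n) (x 0) (Suc n)" for n
  have lim: "e \<longlonglongrightarrow> x \<tau>"
    unfolding e_def[abs_def] by (rule clamped.euler_tendsto_integral_curve[OF x \<tau>])
  have limc: "(\<lambda>n. clamped (e n)) \<longlonglongrightarrow> clamped (x \<tau>)"
    by (rule continuous_on_tendsto_compose[OF clamped.continuous_on_field[of UNIV] lim]) auto
  \<comment> \<open>From \<open>N\<close> on the step size \<open>\<tau> / Suc n\<close> is at most
    1, as the bounds on Euler orbits require.\<close>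
  obtain N :: nat where N: "\<tau> < real N" using reals_Archimedean2 by blast
  have ev: "e n \<in> basin" "energy (e n) \<le> energy (x 0)"
    "norm (v (e n)) \<le> exp (- (\<kappa> * \<tau>)) * norm (v (x 0))" if "N \<le> n" for n
  proof -
    have h: "0 \<le> \<tau> / Suc n" "\<tau> / Suc n \<le> 1" using N that \<tau> by auto
    have "real (Suc n) * (\<tau> / Suc n) = \<tau>" by (simp del: of_nat_Suc)
    then show "e n \<in> basin" "energy (e n) \<le> energy (x 0)"
      "norm (v (e n)) \<le> exp (- (\<kappa> * \<tau>)) * norm (v (x 0))"
      using euler_basin[OF x0 h, of "Suc n"] unfolding e_def euler_clamped[OF x0 h] by simp_all
  qed
  \<comment> \<open>The limit is taken for \<open>clamped\<close>, which is continuous everywhere;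
    only this bound shows that \<open>x \<tau>\<close> is in the ball, where \<open>clamped\<close>
    and \<open>v\<close> agree.\<close>
  have "dist p (x \<tau>) + norm (clamped (x \<tau>)) / \<kappa> \<le> energy (x 0)"
  proof (rule tendsto_upperbound)
    show "(\<lambda>n. dist p (e n) + norm (clamped (e n)) / \<kappa>) \<longlonglongrightarrow> dist p (x \<tau>) + norm (clamped (x \<tau>)) / \<kappa>"
      using \<kappa> by (intro tendsto_intros lim limc) auto
    show "\<forall>\<^sub>F n in sequentially. dist p (e n) + norm (clamped (e n)) / \<kappa> \<le> energy (x 0)"
      using eventually_ge_at_top[of N]
      by eventually_elim (use ev in \<open>simp add: clamped_basin energy_def\<close>)
  qed simp
  then have bound: "dist p (x \<tau>) + norm (clamped (x \<tau>)) / \<kappa> < r"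
    using x0 by (simp add: basin_def)
  moreover have "0 \<le> norm (clamped (x \<tau>)) / \<kappa>" using \<kappa> by simp
  ultimately have ball: "x \<tau> \<in> ball p r" unfolding mem_ball by linarith
  then have eq: "clamped (x \<tau>) = v (x \<tau>)" by (simp add: clamped_eq)
  show "x \<tau> \<in> basin" using bound ball by (simp add: basin_def energy_def eq)
  have "norm (clamped (x \<tau>)) \<le> exp (- (\<kappa> * \<tau>)) * norm (v (x 0))"
  proof (rule tendsto_upperbound)
    show "(\<lambda>n. norm (clamped (e n))) \<longlonglongrightarrow> norm (clamped (x \<tau>))"
      by (intro tendsto_intros limc)
    show "\<forall>\<^sub>F n in sequentially. norm (clamped (e n)) \<le> exp (- (\<kappa> * \<tau>)) * norm (v (x 0))"
      using eventually_ge_at_top[of N]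
      by eventually_elim (use ev in \<open>simp add: clamped_basin\<close>)
  qed simp
  then show "norm (v (x \<tau>)) \<le> exp (- (\<kappa> * \<tau>)) * norm (v (x 0))" by (simp add: eq)
qed

text \<open>At its first exit time a curve would still be a curve of the clamped field, whose curves
  never leave the basin.\<close>

lemma curve_in_ball:
  assumes y: "integral_curve_on v {0..} y" and y0: "y 0 \<in> basin" and t: "0 \<le> t"
  shows "y t \<in> ball p r"
proof (rule ccontr)
  assume "y t \<notin> ball p r"
  define S where "S = {s \<in> {0..}. dist p (y s) \<in> {r..}}"
  have cont: "continuous_on {0..} (\<lambda>s. dist p (y s))"
    by (intro continuous_intros integral_curve_on_continuous[OF y])
  have "S = {0..} \<inter> (\<lambda>s. dist p (y s)) -` {r..}" by (auto simp: S_def)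
  then have "closed S" using continuous_closed_preimage[OF cont] by simp
  moreover have "t \<in> S" using \<open>y t \<notin> ball p r\<close> t by (simp add: S_def)
  moreover have bdd: "bdd_below S" by (rule bdd_belowI[of _ 0]) (simp add: S_def)
  ultimately have \<tau>: "Inf S \<in> S" by (intro closed_contains_Inf) auto
  define \<tau> where "\<tau> = Inf S"
  have \<tau>0: "0 \<le> \<tau>" and \<tau>r: "r \<le> dist p (y \<tau>)" using \<tau> by (auto simp: S_def \<tau>_def)
  have before: "dist p (y s) < r" if "0 \<le> s" "s < \<tau>" for s
  proof (rule ccontr)
    assume "\<not> dist p (y s) < r"
    then have "s \<in> S" using that by (simp add: S_def)
    from cInf_lower[OF this bdd] show False using that by (simp add: \<tau>_def)
  qed
  \<comment> \<open>A time with distance exactly \<open>r\<close> exists by the intermediate value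
    theorem and can only be \<open>\<tau>\<close>, so the curve stays in the closed ball up to and
    including \<open>\<tau>\<close>.\<close>
  have "dist p (y 0) < r" using y0 by (simp add: basin_def)
  then obtain s where s: "0 \<le> s" "s \<le> \<tau>" "dist p (y s) = r"
    using IVT'[of "\<lambda>s. dist p (y s)" 0 r \<tau>] \<tau>0 \<tau>r continuous_on_subset[OF cont, of "{0..\<tau>}"] by auto
  then have "s = \<tau>" using before[of s] by force
  have "integral_curve_on clamped {0..\<tau>} y"
  proof -
    have "y u \<in> cball p r" if "u \<in> {0..\<tau>}" for u
      using before[of u] \<open>s = \<tau>\<close> s(3) that by (cases "u = \<tau>") auto
    then have "integral_curve_on v {0..\<tau>} y \<longleftrightarrow> integral_curve_on clamped {0..\<tau>} y"
      by (intro integral_curve_on_cong) (simp add: clamped_eq)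
    then show ?thesis using integral_curve_on_subset[OF y, of "{0..\<tau>}"] by auto
  qed
  from clamped_curve(1)[OF this y0 \<tau>0] \<tau>r show False by (simp add: basin_def)
qed

lemma curve_clamped:
  assumes "integral_curve_on v {0..} y" "y 0 \<in> basin"
  shows "integral_curve_on clamped {0..} y"
proof -
  have "integral_curve_on v {0..} y \<longleftrightarrow> integral_curve_on clamped {0..} y"
    using curve_in_ball[OF assms] by (intro integral_curve_on_cong) (simp add: clamped_eq less_imp_le)
  with assms show ?thesis by simp
qed

lemma curve_basin_decay:
  assumes y: "integral_curve_on v {0..} y" "y 0 \<in> basin" and t: "0 \<le> t"
  shows "y t \<in> basin" and "norm (v (y t)) \<le> exp (- (\<kappa> * t)) * norm (v (y 0))"
proof -
  have c: "integral_curve_on clamped {0..t} y"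
    by (rule integral_curve_on_subset[OF curve_clamped[OF y]]) simp
  show "y t \<in> basin" by (rule clamped_curve(1)[OF c y(2) t])
  show "norm (v (y t)) \<le> exp (- (\<kappa> * t)) * norm (v (y 0))" by (rule clamped_curve(2)[OF c y(2) t])
qed

text \<open>The field is autonomous, so the curve restarted at time \<open>s\<close> is again a
  curve starting in the basin.\<close>

lemma curve_decay:
  assumes y: "integral_curve_on v {0..} y" "y 0 \<in> basin" and st: "0 \<le> s" "s \<le> t"
  shows "norm (v (y t)) \<le> exp (- (\<kappa> * (t - s))) * norm (v (y s))"
proof -
  define z where "z u = y (s + u)" for u
  have "integral_curve_on v {0..} z"
    unfolding z_def[abs_def] by (rule integral_curve_on_shift[OF y(1) st(1)])
  moreover have "z 0 \<in> basin" using curve_basin_decay(1)[OF y st(1)] by (simp add: z_def)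
  moreover have "0 \<le> t - s" using st by simp
  ultimately have "norm (v (z (t - s))) \<le> exp (- (\<kappa> * (t - s))) * norm (v (z 0))"
    by (rule curve_basin_decay(2))
  then show ?thesis by (simp add: z_def)
qed

text \<open>The global solution for \<open>clamped\<close> never leaves the basin, where the two
  fields agree.\<close>

lemma curve_exists:
  assumes "x0 \<in> basin"
  shows "\<exists>x. x 0 = x0 \<and> integral_curve_on v {0..} x"
proof -
  obtain x where x: "x 0 = x0" "integral_curve_on clamped {0..} x"
    using clamped.integral_curve_exists by blast
  have "x t \<in> basin" if t: "0 \<le> t" for t
  proof (rule clamped_curve(1)[OF _ _ t])
    show "integral_curve_on clamped {0..t} x" by (rule integral_curve_on_subset[OF x(2)]) simp
  qed (use x(1) assms in simp)
  then have "integral_curve_on clamped {0..} x \<longleftrightarrow> integral_curve_on v {0..} x"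
    by (intro integral_curve_on_cong) (simp add: clamped_basin)
  with x show ?thesis by blast
qed

lemma curve_unique:
  assumes "integral_curve_on v {0..} x" "integral_curve_on v {0..} y" "x 0 \<in> basin" "y 0 = x 0" "0 \<le> t"
  shows "y t = x t"
proof -
  have y0: "y 0 \<in> basin" using assms by simp
  have "integral_curve_on clamped {0..t} y"
    by (rule integral_curve_on_subset[OF curve_clamped[OF assms(2) y0]]) simp
  moreover have "integral_curve_on clamped {0..t} x"
    by (rule integral_curve_on_subset[OF curve_clamped[OF assms(1,3)]]) simp
  ultimately show ?thesis using assms(4,5) by (rule clamped.integral_curve_unique)
qed

text \<open>Along the curve \<open>v\<close> agrees with the continuous field
  \<open>clamped\<close>, so the set of hitting times is closed and contains its infimum.\<close>

lemma first_hit: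
  assumes x: "integral_curve_on v {0..} x" "x 0 \<in> basin" and \<tau>: "0 \<le> \<tau>" "norm (v (x \<tau>)) \<le> \<delta>"
  obtains T where "0 \<le> T" "T \<le> \<tau>" "norm (v (x T)) \<le> \<delta>" "\<And>t. 0 \<le> t \<Longrightarrow> t < T \<Longrightarrow> \<delta> < norm (v (x t))"
proof -
  define S where "S = {s \<in> {0..}. norm (v (x s)) \<in> {..\<delta>}}"
  have "continuous_on {0..} (\<lambda>s. norm (clamped (x s)))"
    by (intro continuous_intros continuous_on_compose2[OF clamped.continuous_on_field[of UNIV]]
        integral_curve_on_continuous[OF x(1)]) auto
  then have cont: "continuous_on {0..} (\<lambda>s. norm (v (x s)))"
    by (rule continuous_on_eq) (simp add: clamped_basin curve_basin_decay(1)[OF x])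
  have "S = {0..} \<inter> (\<lambda>s. norm (v (x s))) -` {..\<delta>}" by (auto simp: S_def)
  then have "closed S" using continuous_closed_preimage[OF cont] by simp
  moreover have \<tau>S: "\<tau> \<in> S" using \<tau> by (simp add: S_def)
  moreover have bdd: "bdd_below S" by (rule bdd_belowI[of _ 0]) (simp add: S_def)
  ultimately have Inf: "Inf S \<in> S" by (intro closed_contains_Inf) auto
  show ?thesis
  proof (rule that[of "Inf S"])
    show "Inf S \<le> \<tau>" by (rule cInf_lower[OF \<tau>S bdd])
    fix t assume t: "0 \<le> t" "t < Inf S"
    then have "t \<notin> S" using cInf_lower[OF _ bdd, of t] by linarith
    then show "\<delta> < norm (v (x t))" using t by (simp add: S_def)
  qed (use Inf in \<open>auto simp: S_def\<close>)
qed

text \<open>Both orbits decay at rate \<open>\<kappa>\<close>, so the Euler error \<open>c * \<epsilon>\<close> in the field norm can shift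
  the passage through level \<open>\<delta>\<close> by at most \<open>c / (\<delta> * \<kappa>)\<close> steps in either direction.\<close>

lemma hitting_time_error:
  assumes \<delta>: "0 < \<delta>"
  obtains C where "\<And>\<epsilon> x T. \<lbrakk>0 < \<epsilon>; \<epsilon> \<le> 1; integral_curve_on v {0..} x; x 0 \<in> basin;
      0 \<le> T; T \<le> \<tau>; norm (v (x T)) \<le> \<delta>; \<And>t. 0 \<le> t \<Longrightarrow> t < T \<Longrightarrow> \<delta> < norm (v (x t))\<rbrakk>
    \<Longrightarrow> \<exists>N. norm (v (euler v \<epsilon> (x 0) N)) \<le> \<delta> \<and>
          (\<forall>k. norm (v (euler v \<epsilon> (x 0) k)) \<le> \<delta> \<longrightarrow> N \<le> k) \<and> \<bar>real N * \<epsilon> - T\<bar> \<le> C * \<epsilon>"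
proof -
  \<comment> \<open>The Euler error constant up to time \<open>\<tau> + 1\<close>, times the
    Lipschitz constant that carries it to field values. The extra 1 covers rounding \<open>T\<close>
    up to a grid time.\<close>
  define c where "c = K * (K * r * exp (K * (\<tau> + 1)))"
  have c: "0 < c" using K r by (simp add: c_def)
  \<comment> \<open>Enough steps to bring the level \<open>\<delta> + c * \<epsilon>\<close> down to
    \<open>\<delta>\<close>; since the excess and the decay exponent are both proportional to
    \<open>\<epsilon>\<close>, one \<open>j\<close> serves every \<open>\<epsilon>\<close>.\<close>
  define j where "j = nat \<lceil>c / (\<delta> * \<kappa>)\<rceil>"
  have "c / (\<delta> * \<kappa>) \<le> real j" unfolding j_def by linarith
  then have j: "c \<le> \<delta> * (\<kappa> * real j)" using \<delta> \<kappa> by (simp add: field_simps)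
  show ?thesis
  proof (rule that[of "real j + 1"])
    fix \<epsilon> T :: real and x
    assume \<epsilon>: "0 < \<epsilon>" "\<epsilon> \<le> 1" and x: "integral_curve_on v {0..} x" "x 0 \<in> basin"
      and T: "0 \<le> T" "T \<le> \<tau>" "norm (v (x T)) \<le> \<delta>"
      and min: "\<And>t. 0 \<le> t \<Longrightarrow> t < T \<Longrightarrow> \<delta> < norm (v (x t))"
    have h: "0 \<le> \<epsilon>" "\<epsilon> \<le> 1" using \<epsilon> by auto
    let ?e = "euler v \<epsilon> (x 0)"
    have close: "norm (v (?e k) - v (x (real k * \<epsilon>))) \<le> c * \<epsilon>" if k: "real k * \<epsilon> \<le> \<tau> + 1" for k
    proof -
      have "norm (?e k - x (real k * \<epsilon>)) \<le> K * r * \<epsilon> * exp (K * (real k * \<epsilon>))"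
        using clamped.euler_error[OF integral_curve_on_subset[OF curve_clamped[OF x], of "{0..real k * \<epsilon>}"]
            h(1), of k]
        by (simp add: euler_clamped[OF x(2) h])
      also have "\<dots> \<le> K * r * \<epsilon> * exp (K * (\<tau> + 1))"
        using K r \<epsilon> k by (intro mult_left_mono) auto
      finally have "K * norm (?e k - x (real k * \<epsilon>)) \<le> K * (K * r * \<epsilon> * exp (K * (\<tau> + 1)))"
        using K by (intro mult_left_mono) auto
      moreover have "norm (v (?e k) - v (x (real k * \<epsilon>))) \<le> K * norm (?e k - x (real k * \<epsilon>))"
        using \<epsilon> by (intro lipschitz basin_subset euler_basin(1)[OF x(2) h] curve_basin_decay(1)[OF x]) auto
      ultimately show ?thesis by (simp add: c_def algebra_simps)
    qed
    have drop: "exp (- (\<kappa> * (real j * \<epsilon>))) * (\<delta> + c * \<epsilon>) \<le> \<delta>"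
    proof -
      have "c * \<epsilon> \<le> \<delta> * (\<kappa> * real j) * \<epsilon>" using j \<epsilon> by (intro mult_right_mono) auto
      then have "\<delta> + c * \<epsilon> \<le> \<delta> * (1 + \<kappa> * (real j * \<epsilon>))" by (simp add: algebra_simps)
      also have "\<dots> \<le> \<delta> * exp (\<kappa> * (real j * \<epsilon>))"
        using \<delta> by (intro mult_left_mono exp_ge_add_one_self) auto
      finally have "exp (- (\<kappa> * (real j * \<epsilon>))) * (\<delta> + c * \<epsilon>)
          \<le> exp (- (\<kappa> * (real j * \<epsilon>))) * (\<delta> * exp (\<kappa> * (real j * \<epsilon>)))"
        by (rule mult_left_mono) simp
      also have "\<dots> = \<delta>" by (simp add: exp_minus)
      finally show ?thesis .
    qed
    \<comment> \<open>The first grid time at or after \<open>T\<close>: the flow is still below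
      \<open>\<delta>\<close> there, the Euler orbit below \<open>\<delta> + c * \<epsilon>\<close>,
      and \<open>j\<close> further steps bring it below \<open>\<delta>\<close>.\<close>
    define k where "k = nat \<lceil>T / \<epsilon>\<rceil>"
    have "T / \<epsilon> \<le> real k" "real k \<le> T / \<epsilon> + 1"
      using divide_nonneg_pos[OF T(1) \<epsilon>(1)] unfolding k_def by linarith+
    then have k: "T \<le> real k * \<epsilon>" "real k * \<epsilon> \<le> T + \<epsilon>"
      using \<epsilon>(1) by (simp_all add: field_simps)
    have hit: "norm (v (?e (k + j))) \<le> \<delta>"
    proof -
      have "norm (v (x (real k * \<epsilon>))) \<le> exp (- (\<kappa> * (real k * \<epsilon> - T))) * norm (v (x T))"
        by (rule curve_decay[OF x T(1) k(1)])
      also have "\<dots> \<le> 1 * norm (v (x T))"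
        using \<kappa> k(1) by (intro mult_right_mono) auto
      finally have "norm (v (x (real k * \<epsilon>))) \<le> \<delta>" using T(3) by simp
      moreover have "norm (v (?e k) - v (x (real k * \<epsilon>))) \<le> c * \<epsilon>"
        using k(2) T(2) \<epsilon> by (intro close) auto
      ultimately have ek: "norm (v (?e k)) \<le> \<delta> + c * \<epsilon>"
        using norm_triangle_sub[of "v (?e k)" "v (x (real k * \<epsilon>))"] by linarith
      have "?e (k + j) = euler v \<epsilon> (?e k) j"
        by (simp add: euler_def add.commute[of k j] funpow_add)
      then have "norm (v (?e (k + j))) \<le> exp (- (\<kappa> * (real j * \<epsilon>))) * norm (v (?e k))"
        using euler_basin(3)[OF euler_basin(1)[OF x(2) h] h] by simp
      also have "\<dots> \<le> exp (- (\<kappa> * (real j * \<epsilon>))) * (\<delta> + c * \<epsilon>)"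
        using ek by (intro mult_left_mono) auto
      finally show ?thesis using drop by linarith
    qed
    define N where "N = (LEAST k. norm (v (?e k)) \<le> \<delta>)"
    have N: "norm (v (?e N)) \<le> \<delta>" "\<And>k. norm (v (?e k)) \<le> \<delta> \<Longrightarrow> N \<le> k"
      unfolding N_def by (rule LeastI[of _ "k + j"], rule hit) (rule Least_le)
    have "real N \<le> real (k + j)" using N(2)[OF hit] by (simp only: of_nat_le_iff)
    then have "real N * \<epsilon> \<le> real (k + j) * \<epsilon>" using \<epsilon> by (intro mult_right_mono) auto
    then have upper: "real N * \<epsilon> - T \<le> (real j + 1) * \<epsilon>" using k(2) by (simp add: algebra_simps)
    \<comment> \<open>The same argument with the roles exchanged: otherwise the flow,
      \<open>j\<close> steps after the Euler orbit hits, would be below \<open>\<delta>\<close>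
      before its first hitting time \<open>T\<close>.\<close>
    have lower: "T \<le> real N * \<epsilon> + real j * \<epsilon>"
    proof (rule ccontr)
      define t where "t = real N * \<epsilon> + real j * \<epsilon>"
      have Nt: "0 \<le> real N * \<epsilon>" "real N * \<epsilon> \<le> t" using \<epsilon> by (auto simp: t_def)
      assume "\<not> T \<le> real N * \<epsilon> + real j * \<epsilon>"
      then have t: "t < T" by (simp add: t_def)
      have "norm (v (?e N) - v (x (real N * \<epsilon>))) \<le> c * \<epsilon>"
        using t Nt T(2) by (intro close) auto
      then have "norm (v (x (real N * \<epsilon>))) \<le> \<delta> + c * \<epsilon>"
        using N(1) norm_triangle_sub[of "v (x (real N * \<epsilon>))" "v (?e N)"] by (simp add: norm_minus_commute)
      then have "exp (- (\<kappa> * (t - real N * \<epsilon>))) * norm (v (x (real N * \<epsilon>))) \<le>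
          exp (- (\<kappa> * (real j * \<epsilon>))) * (\<delta> + c * \<epsilon>)"
        by (simp add: t_def)
      with curve_decay[OF x Nt] drop have "norm (v (x t)) \<le> \<delta>" by linarith
      with min[of t] t Nt show False by simp
    qed
    have "\<bar>real N * \<epsilon> - T\<bar> \<le> (real j + 1) * \<epsilon>"
      using upper lower \<epsilon> by (simp add: algebra_simps abs_le_iff)
    with N show "\<exists>N. norm (v (?e N)) \<le> \<delta> \<and> (\<forall>k. norm (v (?e k)) \<le> \<delta> \<longrightarrow> N \<le> k) \<and>
        \<bar>real N * \<epsilon> - T\<bar> \<le> (real j + 1) * \<epsilon>" by blast
  qed
qed

end

section \<open>Hitting times of the RRR flow and iteration\<close>

theorem theorem3p5:
  fixes A B :: "'a::euclidean_space set" and xstar :: 'a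
  assumes "closed A" and "closed B"
    and "C2_submanifold A" and "C2_submanifold B"
    and "transversal_at A B xstar"
  shows "\<exists>c1 > 0. \<exists>c2 > 0. \<exists>\<delta>0 > 0. \<exists>U. open U \<and> xstar \<in> U \<and>
    (\<forall>x0\<in>U. \<exists>x. rrr_solution A B x0 x \<and>
       (\<forall>y. rrr_solution A B x0 y \<longrightarrow> (\<forall>t\<ge>0. y t = x t))) \<and>
    (\<forall>x0\<in>U. \<forall>\<delta>\<in>{0<..\<delta>0}. flow_hitting_time A B \<delta> x0 \<le> ereal (c1 + c2 * ln (1 / \<delta>))) \<and>
    (\<forall>\<delta>\<in>{0<..\<delta>0}. \<forall>K. compact K \<and> K \<subseteq> U \<longrightarrow>
       (\<exists>C. \<forall>\<^sub>F \<epsilon> in at_right 0. \<forall>x0\<in>K.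
          \<bar>discrete_hitting_time A B \<delta> \<epsilon> x0 - flow_hitting_time A B \<delta> x0\<bar> \<le> ereal (C * \<epsilon>)))"
proof -
  let ?v = "rrr_field A B"
  obtain r \<kappa> K where rrr: "0 < r" "0 < \<kappa>" "\<kappa> \<le> 1" "0 < K"
    "\<And>x y. \<lbrakk>x \<in> cball xstar r; y \<in> cball xstar r\<rbrakk> \<Longrightarrow> norm (?v x - ?v y) \<le> K * norm (x - y)"
    "\<And>x h. \<lbrakk>x \<in> cball xstar r; 0 \<le> h; h \<le> 1; x + h *\<^sub>R ?v x \<in> cball xstar r\<rbrakk>
      \<Longrightarrow> norm (?v (x + h *\<^sub>R ?v x)) \<le> (1 - \<kappa> * h) * norm (?v x)"
    using rrr_field_contraction[OF assms] by metis
  have "xstar \<in> A" "xstar \<in> B" using assms(5) unfolding transversal_at_def by auto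
  then have zero: "?v xstar = 0"
    by (simp add: rrr_field_def reflection_def closest_point_self scaleR_2)
  interpret contracting_field ?v xstar r \<kappa> K
    by unfold_locales (rule rrr zero; assumption)+
  have solution: "rrr_solution A B x0 x \<longleftrightarrow> x 0 = x0 \<and> integral_curve_on ?v {0..} x" for x0 x
    by (auto simp: rrr_solution_def integral_curve_on_def)
  have iterate: "rrr_iterate A B \<epsilon> x0 k = euler ?v \<epsilon> x0 k" for \<epsilon> x0 k
    by (simp add: rrr_iterate_def euler_def)
  \<comment> \<open>On the basin the initial field norm is at most \<open>\<kappa> * r\<close>, so
    the flow is below \<open>\<delta>\<close> once \<open>\<kappa> * \<tau>\<close> reaches
    \<open>ln (\<kappa> * r) + ln (1 / \<delta>)\<close>; both constants are read off from this, and
    the maximum with 1 keeps \<open>c1\<close> positive.\<close>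
  define c1 where "c1 = max 1 (ln (\<kappa> * r) / \<kappa>)"
  define c2 where "c2 = 1 / \<kappa>"
  \<comment> \<open>Restricting to \<open>\<delta> \<le> 1\<close> makes
    \<open>ln (1 / \<delta>)\<close> nonnegative, so the time bound is nonnegative and the decay
    estimate applies at it.\<close>
  have hit: "\<exists>x T. x 0 = x0 \<and> integral_curve_on ?v {0..} x \<and> flow_hitting_time A B \<delta> x0 = ereal T \<and>
      0 \<le> T \<and> T \<le> c1 + c2 * ln (1 / \<delta>) \<and> norm (?v (x T)) \<le> \<delta> \<and> (\<forall>t. 0 \<le> t \<longrightarrow> t < T \<longrightarrow> \<delta> < norm (?v (x t)))"
    if x0: "x0 \<in> basin" and \<delta>: "\<delta> \<in> {0<..1}" for x0 \<delta>
  proof -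
    obtain x where x: "x 0 = x0" "integral_curve_on ?v {0..} x" using curve_exists[OF x0] by blast
    have x_basin: "x 0 \<in> basin" using x(1) x0 by simp
    define \<tau> where "\<tau> = c1 + c2 * ln (1 / \<delta>)"
    have \<tau>: "0 \<le> \<tau>" using \<delta> rrr(2) by (simp add: \<tau>_def c1_def c2_def)
    have "ln (\<kappa> * r) \<le> \<kappa> * c1"
      using rrr(2) by (simp add: c1_def max_def field_simps)
    then have "ln (\<kappa> * r / \<delta>) \<le> \<kappa> * \<tau>"
      using \<delta> rrr by (simp add: \<tau>_def c2_def ln_div algebra_simps)
    moreover have "0 < \<kappa> * r / \<delta>" using \<delta> rrr(1,2) by simp
    ultimately have "\<kappa> * r / \<delta> \<le> exp (\<kappa> * \<tau>)" by (metis exp_ln exp_le_cancel_iff)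
    then have decay: "exp (- (\<kappa> * \<tau>)) * (\<kappa> * r) \<le> \<delta>"
      using \<delta> by (simp add: exp_minus field_simps)
    have "norm (?v (x \<tau>)) \<le> exp (- (\<kappa> * \<tau>)) * norm (?v (x 0))"
      by (rule curve_basin_decay(2)[OF x(2) x_basin \<tau>])
    also have "\<dots> \<le> exp (- (\<kappa> * \<tau>)) * (\<kappa> * r)"
      by (intro mult_left_mono norm_le_basin x_basin) simp
    finally have "norm (?v (x \<tau>)) \<le> \<delta>" using decay by linarith
    then obtain T where T: "0 \<le> T" "T \<le> \<tau>" "norm (?v (x T)) \<le> \<delta>"
      "\<And>t. 0 \<le> t \<Longrightarrow> t < T \<Longrightarrow> \<delta> < norm (?v (x t))"
      using first_hit[OF x(2) x_basin \<tau>] by metis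
    \<comment> \<open>The infimum ranges over all solutions from \<open>x0\<close>; by uniqueness
      each of them coincides with \<open>x\<close> at nonnegative times.\<close>
    have "flow_hitting_time A B \<delta> x0 = ereal T"
      unfolding flow_hitting_time_def
    proof (rule antisym)
      show "Inf {ereal t |t x. rrr_solution A B x0 x \<and> 0 \<le> t \<and> norm (?v (x t)) \<le> \<delta>} \<le> ereal T"
        by (rule Inf_lower) (use x T solution in blast)
      show "ereal T \<le> Inf {ereal t |t x. rrr_solution A B x0 x \<and> 0 \<le> t \<and> norm (?v (x t)) \<le> \<delta>}"
      proof (rule Inf_greatest)
        fix z assume "z \<in> {ereal t |t x. rrr_solution A B x0 x \<and> 0 \<le> t \<and> norm (?v (x t)) \<le> \<delta>}"
        then obtain t y where y: "z = ereal t" "rrr_solution A B x0 y" "0 \<le> t" "norm (?v (y t)) \<le> \<delta>"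
          by blast
        have "y t = x t"
          using curve_unique[OF x(2) _ x_basin _ y(3), of y] y(2) x(1) by (simp add: solution)
        with T(4)[OF y(3)] y(4) have "T \<le> t" by force
        with y(1) show "ereal T \<le> z" by simp
      qed
    qed
    with x T show ?thesis unfolding \<tau>_def by blast
  qed
  have pos: "0 < c1" "0 < c2" using rrr(2) by (auto simp: c1_def c2_def)
  show ?thesis
  proof (rule exI[of _ c1], rule conjI[OF pos(1)], rule exI[of _ c2], rule conjI[OF pos(2)],
      rule exI[of _ 1], rule conjI[OF zero_less_one], rule exI[of _ basin],
      intro conjI ballI allI impI)
    show "open basin" "xstar \<in> basin" by (rule open_basin center_in_basin)+
    show "\<exists>x. rrr_solution A B x0 x \<and> (\<forall>y. rrr_solution A B x0 y \<longrightarrow> (\<forall>t\<ge>0. y t = x t))"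
      if x0: "x0 \<in> basin" for x0
    proof -
      obtain x where x: "x 0 = x0" "integral_curve_on ?v {0..} x" using curve_exists[OF x0] by blast
      with x0 show ?thesis using curve_unique[OF x(2)] by (auto simp: solution)
    qed
    show "flow_hitting_time A B \<delta> x0 \<le> ereal (c1 + c2 * ln (1 / \<delta>))"
      if "x0 \<in> basin" "\<delta> \<in> {0<..1}" for x0 \<delta>
      using hit[OF that] by auto
    fix \<delta> :: real and S assume \<delta>: "\<delta> \<in> {0<..1}" and S: "compact S \<and> S \<subseteq> basin"
    \<comment> \<open>The horizon is the logarithmic bound on all first hitting times for this
      \<open>\<delta>\<close>. The resulting \<open>C\<close> holds for every start in the basin,
      hence uniformly on \<open>S\<close>.\<close>
    have "0 < \<delta>" using \<delta> by simp
    from hitting_time_error[OF this, of "c1 + c2 * ln (1 / \<delta>)"] obtain C where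
      C: "\<And>\<epsilon> x T. \<lbrakk>0 < \<epsilon>; \<epsilon> \<le> 1; integral_curve_on ?v {0..} x; x 0 \<in> basin;
        0 \<le> T; T \<le> c1 + c2 * ln (1 / \<delta>); norm (?v (x T)) \<le> \<delta>;
        \<And>t. 0 \<le> t \<Longrightarrow> t < T \<Longrightarrow> \<delta> < norm (?v (x t))\<rbrakk>
      \<Longrightarrow> \<exists>N. norm (?v (euler ?v \<epsilon> (x 0) N)) \<le> \<delta> \<and>
            (\<forall>k. norm (?v (euler ?v \<epsilon> (x 0) k)) \<le> \<delta> \<longrightarrow> N \<le> k) \<and> \<bar>real N * \<epsilon> - T\<bar> \<le> C * \<epsilon>"
      by blast
    have "\<bar>discrete_hitting_time A B \<delta> \<epsilon> x0 - flow_hitting_time A B \<delta> x0\<bar> \<le> ereal (C * \<epsilon>)"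
      if \<epsilon>: "0 < \<epsilon>" "\<epsilon> < 1" and x0: "x0 \<in> S" for \<epsilon> x0
    proof -
      have x0: "x0 \<in> basin" using x0 S by blast
      obtain x T where x: "x 0 = x0" "integral_curve_on ?v {0..} x"
        and T: "flow_hitting_time A B \<delta> x0 = ereal T" "0 \<le> T" "T \<le> c1 + c2 * ln (1 / \<delta>)"
          "norm (?v (x T)) \<le> \<delta>" "\<And>t. 0 \<le> t \<Longrightarrow> t < T \<Longrightarrow> \<delta> < norm (?v (x t))"
        using hit[OF x0 \<delta>] by blast
      have x_basin: "x 0 \<in> basin" using x(1) x0 by simp
      obtain N where N: "norm (?v (euler ?v \<epsilon> (x 0) N)) \<le> \<delta>"
        "\<And>k. norm (?v (euler ?v \<epsilon> (x 0) k)) \<le> \<delta> \<Longrightarrow> N \<le> k" "\<bar>real N * \<epsilon> - T\<bar> \<le> C * \<epsilon>"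
        using C[OF \<epsilon>(1) less_imp_le[OF \<epsilon>(2)] x(2) x_basin T(2-5)] by blast
      have "(LEAST k. norm (?v (rrr_iterate A B \<epsilon> x0 k)) \<le> \<delta>) = N"
        using N(1,2) by (intro Least_equality) (auto simp: iterate x(1))
      moreover have "\<exists>k. norm (?v (rrr_iterate A B \<epsilon> x0 k)) \<le> \<delta>"
        using N(1) by (auto simp: iterate x(1))
      ultimately have "discrete_hitting_time A B \<delta> \<epsilon> x0 = ereal (real N * \<epsilon>)"
        by (simp add: discrete_hitting_time_def)
      with T(1) N(3) show ?thesis by simp
    qed
    then show "\<exists>C. \<forall>\<^sub>F \<epsilon> in at_right 0. \<forall>x0\<in>S.
        \<bar>discrete_hitting_time A B \<delta> \<epsilon> x0 - flow_hitting_time A B \<delta> x0\<bar> \<le> ereal (C * \<epsilon>)"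
      unfolding eventually_at_right_field by (intro exI[of _ C] exI[of _ 1]) auto
  qed
qed

end
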